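(* Let $d\in\mathbb N$ and $\varepsilon>0$. There exist constants $C_1,C_2$, independent of $N$ and $Q$ (depending only on $d$ and $\varepsilon$), such that the following holds. Let $N\in\mathbb N$, let $\{a_{\mathbf n}\}_{\mathbf n\in S_{d,N}}$ be complex numbers with $\sum_{\mathbf n}|a_{\mathbf n}|^2=1$, and let $$F(\mathbf x,t)=\sum_{\mathbf n\in S_{d,N}}a_{\mathbf n}e^{2\pi i\mathbf n\cdot\mathbf x}e^{2\pi i|\mathbf n|^2t},\qquad (\mathbf x,t)\in\mathbb T^d\times\mathbb T .$$ For $\lambda>0$ let $E_\lambda=\{(\mathbf x,t)\in\mathbb T^{d+1}:|F(\mathbf x,t)|>\lambda\}$. Then for any positive number $Q$ with $Q\ge N$ and for all $\lambda>0$, $$\lambda^2|E_\lambda|^2\le C_1Q^{d/2}|E_\lambda|^2+\frac{C_2N^{\varepsilon}}{Q}|E_\lambda| .$$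
   Context: $\mathbb T=\mathbb R/\mathbb Z$ with normalized Lebesgue measure; $|E|$ denotes the Lebesgue measure of a set $E\subset\mathbb T^{d+1}$. $S_{d,N}=\{(n_1,\dots,n_d)\in\mathbb Z^d:|n_j|\le N,\ 1\le j\le d\}$ and $|\mathbf n|^2=n_1^2+\cdots+n_d^2$. *)

theory Defs
  imports "HOL-Analysis.Analysis"
begin

text \<open>The dimension d is \<open>CARD('d)\<close> for an index type \<open>'d\<close> of class finite; since types are
  nonempty, d ranges exactly over the positive integers.\<close>

definition freq_box :: "nat \<Rightarrow> (int ^ 'd::finite) set" where
  "freq_box N = {n. \<forall>j. \<bar>n $ j\<bar> \<le> int N}"

text \<open>The torus \<open>(\<real>/\<int>)\<^sup>d \<times> \<real>/\<int>\<close> is represented by its half-open fundamental domain; under this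
  identification the normalized Lebesgue measure of the torus is the restriction of Lebesgue
  measure on \<open>\<real>\<^sup>d \<times> \<real>\<close>.\<close>

definition torus :: "((real ^ 'd::finite) \<times> real) set" where
  "torus = {(x, t). (\<forall>j. x $ j \<in> {0..<1}) \<and> t \<in> {0..<1}}"

definition exp_sum :: "nat \<Rightarrow> (int ^ 'd::finite \<Rightarrow> complex) \<Rightarrow> real ^ 'd \<Rightarrow> real \<Rightarrow> complex" where
  "exp_sum N a x t =
     (\<Sum>n\<in>freq_box N. a n
        * exp (2 * complex_of_real pi * \<i> * complex_of_real (\<Sum>j\<in>UNIV. real_of_int (n $ j) * x $ j))
        * exp (2 * complex_of_real pi * \<i> * complex_of_real (real_of_int (\<Sum>j\<in>UNIV. (n $ j)\<^sup>2) * t)))"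

definition level_set ::
    "nat \<Rightarrow> (int ^ 'd::finite \<Rightarrow> complex) \<Rightarrow> real \<Rightarrow> ((real ^ 'd) \<times> real) set" where
  "level_set N a lam = {(x, t) \<in> torus. norm (exp_sum N a x t) > lam}"

lemma finite_freq_box: "finite (freq_box N :: (int ^ 'd::finite) set)"
proof -
  have "freq_box N \<subseteq> vec_lambda ` (UNIV \<rightarrow>\<^sub>E {- int N..int N} :: ('d \<Rightarrow> int) set)"
  proof
    fix n :: "int ^ 'd" assume "n \<in> freq_box N"
    then have "vec_nth n \<in> UNIV \<rightarrow>\<^sub>E {- int N..int N}"
      by (auto simp: freq_box_def abs_le_iff minus_le_iff)
    then show "n \<in> vec_lambda ` (UNIV \<rightarrow>\<^sub>E {- int N..int N})"
      by (metis image_eqI vec_nth_inverse)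
  qed
  then show ?thesis
    by (rule finite_subset) (intro finite_imageI finite_PiE; simp)
qed

end

theory Submission
  imports Defs "HOL-Computational_Algebra.Primes"
begin

text \<open>Put \<open>f = cnj F / |F|\<close> on the level set. Cauchy--Schwarz bounds \<open>\<lambda>\<^sup>2 |E|\<^sup>2\<close> by the quadratic form of
  \<open>f\<close> with kernel \<open>K(x, t) = \<Sum> w(n) e(n x + |n|\<^sup>2 t)\<close>, where the weight \<open>w \<ge> 0\<close> is at least 1 on the
  box. Multiply \<open>K\<close> by a function \<open>\<Theta>(t)\<close> of mean 1 that is supported within \<open>1 / q\<^sup>2\<close> of the reduced
  fractions \<open>a / q\<close> with \<open>q\<close> comparable to \<open>Q\<close>. There Weyl's inequality gives \<open>|K| \<lesssim> Q powr (d / 2)\<close>,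
  so \<open>K \<Theta>\<close> contributes the first term. The Fourier coefficients of \<open>\<Theta>\<close> other than the mean are Ramanujan
  sums averaged over \<open>q\<close>, hence at most \<open>N powr \<epsilon> / Q\<close> by the divisor bound when \<open>Q \<le> N\<^sup>2\<close>; by Bessel's inequality
  \<open>K - K \<Theta>\<close> contributes the second term. For \<open>Q > N\<^sup>2\<close> the trivial bound for \<open>|F|\<close> suffices.

  To avoid Fourier series on the torus, all of this is done on translates of the finite subgroup
  \<open>((1/M) \<int> / \<int>)\<close> in each coordinate, with \<open>M\<close> divisible by every \<open>q\<close> that occurs. After division
  by the number of points the estimate is linear in the level set, so it can be averaged over the translates.\<close>

section \<open>Characters of the torus\<close>

text \<open>The inequality actually proved is \<open>(lam^2 - A) |E| <= \<delta>\<close> with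
  \<open>A\<close> of size \<open>Q powr (d / 2)\<close>; multiplying by \<open>|E|\<close> gives
  the theorem. The multiplier has to meet two conflicting demands: it must live where Weyl sums are
  small, yet all its Fourier coefficients except the mean must be about \<open>1 / Q\<close>. A
  single denominator \<open>q\<close> fails the second demand, since its Ramanujan sum at a multiple
  of \<open>q\<close> counts all reduced residues. Using every \<open>q\<close> between
  \<open>n / 4\<close> and \<open>n\<close> brings in about \<open>n^2\<close> fractions, while each
  divisor \<open>d\<close> of the frequency contributes only \<open>d (n / d) = n\<close>, so a
  factor \<open>n\<close> is saved. The bumps are convolution squares, so their own coefficients
  decay like inverse squares; this absorbs the growth of the divisor function at high frequencies,
  and nothing has to be truncated. Their width has two reasons: the fractions are
  \<open>1 / n^2\<close> apart, and Weyl's inequality tolerates an error \<open>1 / q^2\<close>. The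
  modulus \<open>M\<close> exceeds \<open>n!\<close>, but its powers cancel in the normalisation, so
  its size is harmless.\<close>

definition unit_exp :: "real \<Rightarrow> complex" where
  "unit_exp x = cis (2 * pi * x)"

lemma unit_exp_0 [simp]: "unit_exp 0 = 1"
  by (simp add: unit_exp_def)

lemma norm_unit_exp [simp]: "norm (unit_exp x) = 1"
  by (simp add: unit_exp_def)

lemma unit_exp_add: "unit_exp (x + y) = unit_exp x * unit_exp y"
  by (simp add: unit_exp_def cis_mult distrib_left)

lemma cnj_unit_exp: "cnj (unit_exp x) = unit_exp (- x)"
  by (simp add: unit_exp_def cis_cnj)

lemma unit_exp_of_int [simp]: "unit_exp (of_int k) = 1"
  by (simp add: unit_exp_def)

lemma unit_exp_add_int: "unit_exp (x + of_int k) = unit_exp x"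
  by (simp add: unit_exp_add)

lemma unit_exp_cong_int: "x - y \<in> \<int> \<Longrightarrow> unit_exp x = unit_exp y"
  by (metis Ints_cases add_diff_cancel_left' diff_add_cancel unit_exp_add_int add.commute)

lemma unit_exp_power: "unit_exp x ^ n = unit_exp (real n * x)"
  by (simp add: unit_exp_def Complex.DeMoivre mult_ac)

lemma unit_exp_sum: "finite I \<Longrightarrow> unit_exp (\<Sum>i\<in>I. f i) = (\<Prod>i\<in>I. unit_exp (f i))"
  by (induction I rule: finite_induct) (auto simp: unit_exp_add)

lemma unit_exp_eq_1_iff: "unit_exp x = 1 \<longleftrightarrow> x \<in> \<int>"
proof
  assume "unit_exp x = 1"
  then have "exp (\<i> * of_real (2 * pi * x)) = 1" by (simp add: unit_exp_def cis_conv_exp)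
  then obtain n :: int where "2 * pi * x = of_int (2 * n) * pi"
    unfolding exp_eq_1 by auto
  then have "x = of_int n" by simp
  then show "x \<in> \<int>" by simp
qed (auto elim: Ints_cases)

lemma norm_unit_exp_minus_1: "norm (unit_exp x - 1) = 2 * \<bar>sin (pi * x)\<bar>"
  using dist_exp_i_1[of "2 * pi * x"] by (simp add: unit_exp_def cis_conv_exp)

text \<open>For \<open>x <= 1.89\<close> one has \<open>sin x >= x - x^3 / 6 >= 0.4 x\<close>, and
  \<open>0.8 pi > 2\<close>. The range extends beyond \<open>1/2\<close> because the lemma is
  applied to a nearest-integer remainder perturbed by up to \<open>1/10\<close>.\<close>

lemma norm_unit_exp_minus_1_ge:
  assumes "\<bar>y\<bar> \<le> 3/5"
  shows "norm (unit_exp y - 1) \<ge> 2 * \<bar>y\<bar>"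
proof -
  have pi: "pi > 3" "pi < 3.15" using pi_approx by auto
  define x where "x = pi * \<bar>y\<bar>"
  have x: "0 \<le> x" "x \<le> 1.89"
  proof -
    have "x \<le> 3.15 * (3/5)" unfolding x_def using pi assms by (intro mult_mono) auto
    then show "x \<le> 1.89" by simp
  qed (simp add: x_def)
  have "(\<Sum>m<3. sin_coeff m * x ^ m) = x"
    by (simp add: numeral_3_eq_3 sin_coeff_def)
  moreover have "inverse (fact 3) * \<bar>x\<bar> ^ 3 = x ^ 3 / 6"
  proof -
    have "(fact 3 :: real) = 6" by (simp add: fact_numeral)
    then show ?thesis using x(1) by (simp only: abs_of_nonneg divide_inverse mult.commute)
  qed
  ultimately have "\<bar>sin x - x\<bar> \<le> x ^ 3 / 6"
    using Maclaurin_sin_bound[of x 3] by (simp only:)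
  then have 1: "sin x \<ge> x - x ^ 3 / 6"
    by linarith
  have "x * x \<le> 1.89 * 1.89" using x by (intro mult_mono) auto
  then have "x * (x * x) \<le> x * 3.6" using x by (intro mult_left_mono) auto
  with 1 have 2: "sin x \<ge> 0.4 * x" unfolding power3_eq_cube mult.assoc by linarith
  have "norm (unit_exp y - 1) = 2 * \<bar>sin x\<bar>"
    unfolding norm_unit_exp_minus_1 x_def by (cases "y \<ge> 0") simp_all
  moreover have "0.8 * pi * \<bar>y\<bar> \<ge> 2 * \<bar>y\<bar>" using pi by (intro mult_right_mono) auto
  then have "0.8 * x \<ge> 2 * \<bar>y\<bar>" unfolding x_def by linarith
  ultimately show ?thesis using 2 by linarith
qed

text \<open>A geometric sum of an \<open>M\<close>-th root of unity. The free start \<open>b\<close>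
  covers both \<open>{0..<r}\<close> and the symmetric window \<open>{- H..<H}\<close> of length
  \<open>2 H\<close>.\<close>

lemma sum_unit_exp_multiples:
  fixes y b :: int and M :: nat
  assumes "M > 0"
  shows "(\<Sum>k\<in>{b..<b + int M}. unit_exp (of_int k * of_int y / real M)) = (if int M dvd y then of_nat M else 0)"
proof -
  define w where "w = unit_exp (of_int y / real M)"
  have "(\<Sum>k\<in>{b..<b + int M}. unit_exp (of_int k * of_int y / real M))
      = (\<Sum>i<M. unit_exp (of_int (b + int i) * of_int y / real M))"
    by (rule sum.reindex_bij_witness[of _ "\<lambda>i. b + int i" "\<lambda>k. nat (k - b)"]) auto
  also have "\<dots> = (\<Sum>i<M. unit_exp (of_int b * of_int y / real M) * w ^ i)"
    by (intro sum.cong refl)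
       (simp add: w_def unit_exp_power unit_exp_add[symmetric] add_divide_distrib distrib_right)
  also have "\<dots> = unit_exp (of_int b * of_int y / real M) * (\<Sum>i<M. w ^ i)"
    by (simp add: sum_distrib_left)
  finally have *: "(\<Sum>k\<in>{b..<b + int M}. unit_exp (of_int k * of_int y / real M)) = \<dots>" .
  show ?thesis
  proof (cases "int M dvd y")
    case True
    then obtain c where c: "y = int M * c" by blast
    have "w = 1" using assms by (simp add: w_def c)
    moreover have "unit_exp (of_int b * of_int y / real M) = 1"
    proof -
      have "of_int b * of_int y / real M = of_int (b * c)" using assms by (simp add: c)
      then show ?thesis by (metis unit_exp_of_int)
    qed
    ultimately show ?thesis unfolding * using True by simp
  next
    case False
    have "w \<noteq> 1"
    proof
      assume "w = 1"
      then obtain c where "of_int y / real M = of_int c"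
        unfolding w_def unit_exp_eq_1_iff by (auto elim: Ints_cases)
      then have "real_of_int y = of_int (c * int M)" using assms by (simp add: field_simps)
      then have "y = c * int M" by linarith
      with False show False by simp
    qed
    moreover have "w ^ M = 1" using assms by (simp add: w_def unit_exp_power)
    ultimately have "(\<Sum>i<M. w ^ i) = 0" by (simp add: geometric_sum)
    then show ?thesis unfolding * using False by simp
  qed
qed

section \<open>Weyl's inequality without logarithm\<close>

text \<open>Multiplication by \<open>unit_exp \<theta>\<close> shifts the weight by one, and there
  are no boundary terms because \<open>g\<close> vanishes off \<open>{a..b}\<close>. The difference
  can be nonzero already at \<open>a - 1\<close>, hence the longer range.\<close>

lemma summation_by_parts_unit_exp:
  fixes g :: "int \<Rightarrow> real"
  assumes supp: "\<And>m. m \<notin> {a..b} \<Longrightarrow> g m = 0"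
  shows "norm (\<Sum>m\<in>{a..b}. of_real (g m) * unit_exp (of_int m * \<theta>)) * norm (unit_exp \<theta> - 1)
       = norm (\<Sum>m\<in>{a-1..b}. of_real (g (m + 1) - g m) * unit_exp (of_int m * \<theta>))"
    (is "norm ?S * _ = norm ?D")
proof -
  have 1: "(\<Sum>m\<in>{a-1..b}. of_real (g (m + 1)) * unit_exp (of_int (m + 1) * \<theta>)) = ?S"
  proof -
    have "(\<Sum>m\<in>{a-1..b}. of_real (g (m + 1)) * unit_exp (of_int (m + 1) * \<theta>))
        = (\<Sum>m\<in>{a..b+1}. of_real (g m) * unit_exp (of_int m * \<theta>))"
      by (rule sum.reindex_bij_witness[of _ "\<lambda>m. m - 1" "\<lambda>m. m + 1"]) auto
    also have "\<dots> = ?S" by (rule sum.mono_neutral_right) (auto simp: supp)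
    finally show ?thesis .
  qed
  have 2: "(\<Sum>m\<in>{a-1..b}. of_real (g m) * unit_exp (of_int m * \<theta>)) = ?S"
    by (rule sum.mono_neutral_right) (auto simp: supp)
  have "unit_exp \<theta> * ?D = (\<Sum>m\<in>{a-1..b}. of_real (g (m + 1)) * unit_exp (of_int (m + 1) * \<theta>))
        - unit_exp \<theta> * (\<Sum>m\<in>{a-1..b}. of_real (g m) * unit_exp (of_int m * \<theta>))"
    unfolding sum_distrib_left sum_subtractf[symmetric]
    by (intro sum.cong refl) (simp add: algebra_simps unit_exp_add)
  also have "\<dots> = - (?S * (unit_exp \<theta> - 1))" unfolding 1 2 by (simp add: algebra_simps)
  finally have "norm (unit_exp \<theta> * ?D) = norm (?S * (unit_exp \<theta> - 1))" by simp
  then show ?thesis by (simp add: norm_mult)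
qed

lemma norm_sum_unit_exp_second_difference:
  fixes g :: "int \<Rightarrow> real"
  assumes supp: "\<And>m. m \<notin> {a..b} \<Longrightarrow> g m = 0"
  shows "norm (\<Sum>m\<in>{a..b}. of_real (g m) * unit_exp (of_int m * \<theta>)) * (norm (unit_exp \<theta> - 1))\<^sup>2
       \<le> (\<Sum>m\<in>{a-2..b}. \<bar>g (m + 2) - 2 * g (m + 1) + g m\<bar>)"
proof -
  let ?g' = "\<lambda>m. g (m + 1) - g m"
  have "norm (\<Sum>m\<in>{a..b}. of_real (g m) * unit_exp (of_int m * \<theta>)) * (norm (unit_exp \<theta> - 1))\<^sup>2
      = norm (\<Sum>m\<in>{a-1..b}. of_real (?g' m) * unit_exp (of_int m * \<theta>)) * norm (unit_exp \<theta> - 1)"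
    using summation_by_parts_unit_exp[of a b g \<theta>, OF supp] by (simp add: power2_eq_square mult.assoc)
  also have "\<dots> = norm (\<Sum>m\<in>{a-1-1..b}. of_real (?g' (m + 1) - ?g' m) * unit_exp (of_int m * \<theta>))"
    by (rule summation_by_parts_unit_exp) (auto simp: supp)
  also have "\<dots> \<le> (\<Sum>m\<in>{a-2..b}. \<bar>?g' (m + 1) - ?g' m\<bar>)"
    by (rule order.trans[OF norm_sum]) (simp add: norm_mult flip: of_real_diff)
  also have "\<dots> = (\<Sum>m\<in>{a-2..b}. \<bar>g (m + 2) - 2 * g (m + 1) + g m\<bar>)"
    by (intro sum.cong refl) (simp add: algebra_simps)
  finally show ?thesis .
qed

text \<open>A piecewise linear weight has second differences of total mass \<open>O(1 / N)\<close>; a sharp cutoff would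
  cost a factor \<open>log q\<close> in Weyl's inequality.\<close>

definition tent :: "nat \<Rightarrow> int \<Rightarrow> real" where
  "tent N m = max 0 (2 - \<bar>of_int m\<bar> / real N)"

lemma tent_nonneg: "tent N m \<ge> 0"
  by (simp add: tent_def)

lemma tent_le_2: "tent N m \<le> 2"
  by (simp add: tent_def)

lemma tent_ge_1: "N > 0 \<Longrightarrow> \<bar>m\<bar> \<le> int N \<Longrightarrow> tent N m \<ge> 1"
  by (auto simp: tent_def field_simps)

lemma tent_eq_0: "N > 0 \<Longrightarrow> \<bar>m\<bar> \<ge> 2 * int N \<Longrightarrow> tent N m = 0"
proof -
  assume "N > 0" "\<bar>m\<bar> \<ge> 2 * int N"
  moreover from this have "\<bar>real_of_int m\<bar> \<ge> 2 * real N" by linarith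
  ultimately show ?thesis by (auto simp: tent_def field_simps)
qed

lemma abs_tent_diff:
  assumes "N > 0"
  shows "\<bar>tent N (m + 1) - tent N m\<bar> \<le> (if m \<in> {- 2 * int N..<2 * int N} then 1 / real N else 0)"
proof (cases "m \<in> {- 2 * int N..<2 * int N}")
  case True
  have "\<bar>tent N (m + 1) - tent N m\<bar> \<le> \<bar>\<bar>of_int (m + 1)\<bar> / real N - \<bar>of_int m\<bar> / real N\<bar>"
    unfolding tent_def by linarith
  also have "\<dots> = \<bar>\<bar>of_int (m + 1)\<bar> - \<bar>of_int m\<bar>\<bar> / real N"
    by (simp flip: diff_divide_distrib)
  also have "\<dots> \<le> 1 / real N" by (intro divide_right_mono) auto
  finally show ?thesis using True by simp
next
  case False
  then have "tent N (m + 1) = 0" "tent N m = 0" using assms by (auto intro!: tent_eq_0)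
  then show ?thesis using False by simp
qed

text \<open>The second differences of a piecewise linear function sit at its kinks, here
  \<open>- 2 N\<close>, \<open>0\<close> and \<open>2 N\<close>, and measure the change of slope.
  The three points are centred at \<open>m + 1\<close>, so \<open>m\<close> is one less than the
  kink.\<close>

lemma abs_tent_second_diff:
  assumes "N > 0"
  shows "\<bar>tent N (m + 2) - 2 * tent N (m + 1) + tent N m\<bar>
      \<le> (if m = - 2 * int N - 1 then 1 / real N else 0) + (if m = - 1 then 2 / real N else 0)
        + (if m = 2 * int N - 1 then 1 / real N else 0)"
proof -
  have pw: "tent N k = (if \<bar>k\<bar> \<le> 2 * int N then 2 - \<bar>of_int k\<bar> / real N else 0)" for k
  proof (cases "\<bar>k\<bar> \<le> 2 * int N")
    case True
    then have "\<bar>real_of_int k\<bar> \<le> 2 * real N" by linarith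
    then have "\<bar>real_of_int k\<bar> / real N \<le> 2" using assms by (simp add: field_simps)
    then show ?thesis using True by (simp add: tent_def)
  qed (use assms in \<open>simp add: tent_eq_0\<close>)
  have neg: "tent N k = 2 + of_int k / real N" if "- 2 * int N \<le> k" "k \<le> 0" for k
  proof -
    have "\<bar>real_of_int k\<bar> = - of_int k" using that by simp
    then show ?thesis using that unfolding pw by simp
  qed
  consider "m < - 2 * int N - 1" | "m = - 2 * int N - 1" | "- 2 * int N \<le> m" "m < - 1" | "m = -1"
    | "- 1 < m" "m < 2 * int N - 1" | "m = 2 * int N - 1" | "m > 2 * int N - 1" by linarith
  then show ?thesis
  proof cases
    case 2
    have "m + 2 = - (2 * int N - 1)" "m + 1 = - 2 * int N" using 2 by auto
    then have "tent N m = 0" "tent N (m + 1) = 0" "tent N (m + 2) = 1 / real N"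
      using assms 2 unfolding pw by (auto simp: field_simps)
    then show ?thesis using 2 by simp
  next
    case 3
    then have "tent N m = 2 + of_int m / real N" "tent N (m + 1) = 2 + of_int (m + 1) / real N"
       "tent N (m + 2) = 2 + of_int (m + 2) / real N" using neg[of m] neg[of "m + 1"] neg[of "m + 2"] by auto
    then have "tent N (m + 2) - 2 * tent N (m + 1) + tent N m = 0"
      by (simp add: add_divide_distrib)
    then show ?thesis by simp
  next
    case 4
    have "tent N (m + 2) = 2 - 1 / real N" "tent N (m + 1) = 2" "tent N m = 2 - 1 / real N"
      using assms 4 unfolding pw by auto
    then show ?thesis using 4 by simp
  next
    case 5
    then have "tent N m = 2 - of_int m / real N" "tent N (m + 1) = 2 - of_int (m + 1) / real N"
       "tent N (m + 2) = 2 - of_int (m + 2) / real N" unfolding pw by auto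
    then have "tent N (m + 2) - 2 * tent N (m + 1) + tent N m = 0"
      by (simp add: add_divide_distrib)
    then show ?thesis by simp
  next
    case 6
    have "tent N (m + 2) = 0" "tent N (m + 1) = 0" "tent N m = 1 / real N"
      using assms 6 unfolding pw by (auto simp: field_simps)
    then show ?thesis using 6 by simp
  qed (use assms in \<open>simp_all add: tent_eq_0\<close>)
qed

lemma sum_abs_tent_diff_le:
  assumes "N > 0" "finite I"
  shows "(\<Sum>m\<in>I. \<bar>tent N (m + h + 1) - tent N (m + h)\<bar>) \<le> 4"
proof -
  have "(\<Sum>m\<in>I. \<bar>tent N (m + h + 1) - tent N (m + h)\<bar>)
      \<le> (\<Sum>m\<in>I. if m \<in> {- 2 * int N - h..<2 * int N - h} then 1 / real N else 0)"
    by (intro sum_mono order.trans[OF abs_tent_diff[OF assms(1)]]) auto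
  also have "\<dots> = (\<Sum>m\<in>I \<inter> {- 2 * int N - h..<2 * int N - h}. 1 / real N)"
    using assms(2) by (simp add: sum.If_cases Int_def)
  also have "\<dots> \<le> (\<Sum>m\<in>{- 2 * int N - h..<2 * int N - h}. 1 / real N)"
    by (rule sum_mono2) auto
  also have "\<dots> = 4" using assms(1) by simp
  finally show ?thesis .
qed

lemma sum_abs_tent_second_diff_le:
  assumes "N > 0" "finite I"
  shows "(\<Sum>m\<in>I. \<bar>tent N (m + h + 2) - 2 * tent N (m + h + 1) + tent N (m + h)\<bar>) \<le> 4 / real N"
proof -
  have *: "(\<Sum>m\<in>I. if m + h = c then x else 0) \<le> x" if "x \<ge> 0" for c and x :: real
  proof -
    have "(\<Sum>m\<in>I. if m + h = c then x else 0) = (\<Sum>m\<in>I. if m = c - h then x else 0)"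
      by (intro sum.cong) auto
    then show ?thesis using that assms(2) by (simp add: sum.delta)
  qed
  have "(\<Sum>m\<in>I. \<bar>tent N (m + h + 2) - 2 * tent N (m + h + 1) + tent N (m + h)\<bar>)
      \<le> (\<Sum>m\<in>I. (if m + h = - 2 * int N - 1 then 1 / real N else 0) + (if m + h = - 1 then 2 / real N else 0)
        + (if m + h = 2 * int N - 1 then 1 / real N else 0))"
    by (intro sum_mono abs_tent_second_diff assms)
  also have "\<dots> \<le> 1 / real N + 2 / real N + 1 / real N"
    unfolding sum.distrib by (intro add_mono *) auto
  finally show ?thesis by simp
qed

text \<open>Discrete Leibniz rule. Each of its three terms has mass at most \<open>8 / N\<close>: a
  second difference of mass \<open>4 / N\<close> meets a factor at most 2, and the mixed term is
  bounded by \<open>2 (1 / N) 4\<close>.\<close>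

lemma sum_abs_tent_product_second_diff_le:
  fixes h :: int
  assumes "N > 0" "finite I"
  defines "g \<equiv> \<lambda>m. tent N (m + h) * tent N m"
  shows "(\<Sum>m\<in>I. \<bar>g (m + 2) - 2 * g (m + 1) + g m\<bar>) \<le> 24 / real N"
proof -
  let ?d = "\<lambda>m. tent N (m + 1) - tent N m"
  let ?D = "\<lambda>m. tent N (m + 2) - 2 * tent N (m + 1) + tent N m"
  have d: "\<bar>?d m\<bar> \<le> 1 / real N" for m
    using abs_tent_diff[OF assms(1), of m] by (auto split: if_splits intro: order.trans)
  have ptw: "\<bar>g (m + 2) - 2 * g (m + 1) + g m\<bar>
     \<le> 2 * \<bar>?D (m + 0)\<bar> + 2 * (1 / real N) * \<bar>?d (m + 0)\<bar> + 2 * \<bar>?D (m + h)\<bar>" for m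
  proof -
    have eq: "g (m + 2) - 2 * g (m + 1) + g m
        = tent N (m + h + 2) * ?D m + 2 * ?d (m + h + 1) * ?d (m + 0) + ?D (m + h) * tent N m"
      unfolding g_def by (simp add: algebra_simps)
    have "\<bar>g (m + 2) - 2 * g (m + 1) + g m\<bar> \<le> \<bar>tent N (m + h + 2) * ?D m\<bar> + \<bar>2 * ?d (m + h + 1) * ?d (m + 0)\<bar> + \<bar>?D (m + h) * tent N m\<bar>"
      unfolding eq by linarith
    also have "\<dots> = tent N (m + h + 2) * \<bar>?D m\<bar> + 2 * \<bar>?d (m + h + 1)\<bar> * \<bar>?d (m + 0)\<bar> + tent N m * \<bar>?D (m + h)\<bar>"
      by (simp only: abs_mult abs_of_nonneg[OF tent_nonneg] abs_numeral mult_ac)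
    also have "\<dots> \<le> 2 * \<bar>?D m\<bar> + 2 * (1 / real N) * \<bar>?d (m + 0)\<bar> + 2 * \<bar>?D (m + h)\<bar>"
    proof -
      have "tent N (m + h + 2) * \<bar>?D m\<bar> \<le> 2 * \<bar>?D m\<bar>"
        by (rule mult_right_mono[OF tent_le_2]) simp
      moreover have "tent N m * \<bar>?D (m + h)\<bar> \<le> 2 * \<bar>?D (m + h)\<bar>"
        by (rule mult_right_mono[OF tent_le_2]) simp
      moreover have "2 * \<bar>?d (m + h + 1)\<bar> * \<bar>?d (m + 0)\<bar> \<le> 2 * (1 / real N) * \<bar>?d (m + 0)\<bar>"
        by (rule mult_right_mono[OF mult_left_mono[OF d]]) simp_all
      ultimately show ?thesis by linarith
    qed
    finally show ?thesis by simp
  qed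
  have "(\<Sum>m\<in>I. \<bar>g (m + 2) - 2 * g (m + 1) + g m\<bar>)
     \<le> (\<Sum>m\<in>I. 2 * \<bar>?D (m + 0)\<bar> + 2 * (1 / real N) * \<bar>?d (m + 0)\<bar> + 2 * \<bar>?D (m + h)\<bar>)"
    by (intro sum_mono ptw)
  also have "\<dots> = 2 * (\<Sum>m\<in>I. \<bar>?D (m + 0)\<bar>) + 2 * (1 / real N) * (\<Sum>m\<in>I. \<bar>?d (m + 0)\<bar>) + 2 * (\<Sum>m\<in>I. \<bar>?D (m + h)\<bar>)"
    by (simp only: sum.distrib sum_distrib_left)
  also have "\<dots> \<le> 2 * (4 / real N) + 2 * (1 / real N) * 4 + 2 * (4 / real N)"
  proof -
    have "(\<Sum>m\<in>I. \<bar>?D (m + 0)\<bar>) \<le> 4 / real N" "(\<Sum>m\<in>I. \<bar>?D (m + h)\<bar>) \<le> 4 / real N"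
      using sum_abs_tent_second_diff_le[OF assms(1,2), of 0] sum_abs_tent_second_diff_le[OF assms(1,2), of h]
      by simp_all
    moreover have "2 * (1 / real N) * (\<Sum>m\<in>I. \<bar>?d (m + 0)\<bar>) \<le> 2 * (1 / real N) * 4"
      using sum_abs_tent_diff_le[OF assms(1,2), of 0] by (intro mult_left_mono) simp_all
    ultimately show ?thesis by linarith
  qed
  finally show ?thesis by simp
qed

text \<open>The terms equal \<open>N\<close> up to \<open>r\<close> about \<open>q / N\<close> and
  decay like inverse squares beyond, so either range contributes \<open>O(q)\<close>.\<close>

lemma sum_min_inverse_square_le:
  fixes N q :: real
  assumes "0 < N" "N \<le> q"
  shows "(\<Sum>r=1..R. min N (q\<^sup>2 / (N * (real r)\<^sup>2))) \<le> 4 * q"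
proof -
  define \<delta> where "\<delta> = N / q"
  have \<delta>: "0 < \<delta>" "\<delta> \<le> 1" using assms by (auto simp: \<delta>_def)
  have qN: "q * \<delta> = N" using assms by (simp add: \<delta>_def)
  \<comment> \<open>With \<open>y = \<delta> (r + 1)\<close>, a term is \<open>N min 1 (1 / y\<^sup>2) \<le> 4 N / ((1 + y - \<delta>) (1 + y))\<close>, which telescopes.\<close>
  have step: "min N (q\<^sup>2 / (N * (real (Suc r))\<^sup>2)) \<le> 4 * q * (1 / (1 + \<delta> * real r) - 1 / (1 + \<delta> * real (Suc r)))" for r
  proof -
    define y where "y = \<delta> * real (Suc r)"
    have y: "0 < y" "y - \<delta> \<ge> 0" using \<delta> by (auto simp: y_def distrib_left intro!: add_pos_nonneg)
    have ym: "1 + \<delta> * real r = 1 + y - \<delta>" by (simp add: y_def algebra_simps)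
    have "q\<^sup>2 / (N * s\<^sup>2) = N / (\<delta> * s)\<^sup>2" for s
      using assms by (simp add: \<delta>_def power_mult_distrib power_divide power2_eq_square)
    then have "q\<^sup>2 / (N * (real (Suc r))\<^sup>2) = N / y\<^sup>2" unfolding y_def by blast
    moreover have "min N (N / y\<^sup>2) \<le> 4 * N / ((1 + y - \<delta>) * (1 + y))"
    proof (cases "y \<le> 1")
      case True
      have "(1 + y - \<delta>) * (1 + y) \<le> 2 * 2" using True \<delta> y by (intro mult_mono) auto
      moreover have pos: "(1 + y - \<delta>) * (1 + y) > 0" using \<delta> y by (intro mult_pos_pos) auto
      ultimately have "N * ((1 + y - \<delta>) * (1 + y)) \<le> N * 4" using assms by (intro mult_left_mono) auto
      then have "N \<le> 4 * N / ((1 + y - \<delta>) * (1 + y))"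
        using pos by (simp add: pos_le_divide_eq mult.commute)
      then show ?thesis by simp
    next
      case False
      have "(1 + y - \<delta>) * (1 + y) \<le> (2 * y) * (2 * y)" using False \<delta> y by (intro mult_mono) auto
      moreover have pos: "(1 + y - \<delta>) * (1 + y) > 0" using \<delta> y by (intro mult_pos_pos) auto
      ultimately have "N * ((1 + y - \<delta>) * (1 + y)) \<le> N * (4 * y\<^sup>2)"
        using assms by (intro mult_left_mono) (auto simp: power2_eq_square)
      then have "N / y\<^sup>2 \<le> 4 * N / ((1 + y - \<delta>) * (1 + y))"
        using pos y by (simp add: divide_simps mult_ac)
      then show ?thesis by simp
    qed
    moreover have "4 * q * (1 / (1 + \<delta> * real r) - 1 / (1 + \<delta> * real (Suc r)))
        = 4 * N / ((1 + y - \<delta>) * (1 + y))"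
    proof -
      have "1 / (1 + y - \<delta>) - 1 / (1 + y) = \<delta> / ((1 + y - \<delta>) * (1 + y))"
        using y by (simp add: divide_simps)
      then show ?thesis unfolding ym y_def[symmetric] using qN
        by (metis (no_types, lifting) mult.assoc times_divide_eq_right)
    qed
    ultimately show ?thesis by simp
  qed
  have "(\<Sum>r=1..R. min N (q\<^sup>2 / (N * (real r)\<^sup>2))) \<le> 4 * q * (1 - 1 / (1 + \<delta> * real R))"
  proof (induction R)
    case (Suc R)
    then show ?case using step[of R] by (simp add: algebra_simps)
  qed simp
  also have "\<dots> \<le> 4 * q * 1" using assms \<delta> by (intro mult_left_mono) auto
  finally show ?thesis by simp
qed

section \<open>Weyl differencing\<close>

definition weyl_sum :: "nat \<Rightarrow> real \<Rightarrow> real \<Rightarrow> complex" where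
  "weyl_sum N x t = (\<Sum>m\<in>{-2 * int N..2 * int N}. of_real (tent N m) * unit_exp (of_int m * x + (of_int m)\<^sup>2 * t))"

text \<open>The share in \<open>|weyl_sum|^2\<close> of the frequency pairs
  \<open>(m + h, m)\<close>, up to a unimodular factor. That factor contains \<open>x\<close>; what
  remains has a phase linear in \<open>m\<close> with frequency \<open>2 h t\<close>.\<close>

definition weyl_correlation :: "nat \<Rightarrow> real \<Rightarrow> int \<Rightarrow> complex" where
  "weyl_correlation N t h = (\<Sum>m\<in>{-2 * int N..2 * int N}.
     of_real (tent N (m + h) * tent N m) * unit_exp (of_int m * (2 * of_int h * t)))"

text \<open>Square out and sort the pairs by their difference \<open>h\<close>. Since
  \<open>tent\<close> vanishes from \<open>2 N\<close> on, the same range of \<open>h\<close> may be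
  used for every \<open>m'\<close>, which makes the two sums interchangeable.\<close>

lemma norm_weyl_sum_squared_le:
  assumes "N > 0"
  shows "(norm (weyl_sum N x t))\<^sup>2 \<le> (\<Sum>h\<in>{-4 * int N..4 * int N}. norm (weyl_correlation N t h))"
proof -
  let ?I = "{-2 * int N..2 * int N}" and ?J = "{-4 * int N..4 * int N}"
  let ?u = "\<lambda>m. of_real (tent N m) * unit_exp (of_int m * x + (of_int m)\<^sup>2 * t)"
  have shift: "(\<Sum>m\<in>?I. ?u m) = (\<Sum>h\<in>?J. ?u (m' + h))" if "m' \<in> ?I" for m'
  proof -
    have "(\<Sum>h\<in>?J. ?u (m' + h)) = (\<Sum>m\<in>{m' - 4 * int N..m' + 4 * int N}. ?u m)"
      by (rule sum.reindex_bij_witness[of _ "\<lambda>m. m - m'" "\<lambda>h. m' + h"]) auto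
    also have "\<dots> = (\<Sum>m\<in>?I. ?u m)"
      using that by (intro sum.mono_neutral_right) (auto simp: tent_eq_0[OF assms])
    finally show ?thesis by simp
  qed
  have "of_real ((norm (weyl_sum N x t))\<^sup>2) = weyl_sum N x t * cnj (weyl_sum N x t)"
    by (rule complex_norm_square)
  also have "\<dots> = (\<Sum>m'\<in>?I. cnj (?u m') * (\<Sum>m\<in>?I. ?u m))"
    unfolding weyl_sum_def cnj_sum by (subst mult.commute) (rule sum_distrib_right)
  also have "\<dots> = (\<Sum>m'\<in>?I. \<Sum>h\<in>?J. cnj (?u m') * ?u (m' + h))"
    by (intro sum.cong refl) (simp only: shift sum_distrib_left)
  also have "\<dots> = (\<Sum>h\<in>?J. \<Sum>m'\<in>?I. cnj (?u m') * ?u (m' + h))"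
    by (rule sum.swap)
  also have "\<dots> = (\<Sum>h\<in>?J. unit_exp (of_int h * x + (of_int h)\<^sup>2 * t) * weyl_correlation N t h)"
  proof (intro sum.cong refl)
    fix h assume "h \<in> ?J"
    have "cnj (?u m') * ?u (m' + h)
        = unit_exp (of_int h * x + (of_int h)\<^sup>2 * t) * (of_real (tent N (m' + h) * tent N m') *
           unit_exp (of_int m' * (2 * of_int h * t)))" for m'
    proof -
      have "of_int (m' + h) * x + (of_int (m' + h))\<^sup>2 * t
        = (of_int m' * x + (of_int m')\<^sup>2 * t) + (of_int h * x + (of_int h)\<^sup>2 * t) + of_int m' * (2 * of_int h * t)"
        by (simp add: power2_eq_square algebra_simps)
      then have "unit_exp (of_int (m' + h) * x + (of_int (m' + h))\<^sup>2 * t)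
         = unit_exp (of_int m' * x + (of_int m')\<^sup>2 * t) * unit_exp (of_int h * x + (of_int h)\<^sup>2 * t)
            * unit_exp (of_int m' * (2 * of_int h * t))" by (simp only: unit_exp_add)
      moreover have "cnj (unit_exp y) * unit_exp y = 1" for y
        using unit_exp_add[of "-y" y] by (simp add: cnj_unit_exp)
      ultimately show ?thesis by (simp add: algebra_simps)
    qed
    then show "(\<Sum>m'\<in>?I. cnj (?u m') * ?u (m' + h))
       = unit_exp (of_int h * x + (of_int h)\<^sup>2 * t) * weyl_correlation N t h"
      by (simp only: weyl_correlation_def sum_distrib_left)
  qed
  finally have "(norm (weyl_sum N x t))\<^sup>2 = norm (\<Sum>h\<in>?J. unit_exp (of_int h * x + (of_int h)\<^sup>2 * t) * weyl_correlation N t h)"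
    by (metis abs_of_nonneg norm_of_real zero_le_power2)
  also have "\<dots> \<le> (\<Sum>h\<in>?J. norm (weyl_correlation N t h))"
    by (rule order.trans[OF norm_sum]) (simp add: norm_mult)
  finally show ?thesis .
qed

lemma norm_weyl_correlation_le:
  assumes "N > 0"
  shows "norm (weyl_correlation N t h) \<le> 24 * real N"
proof -
  have "norm (weyl_correlation N t h) \<le> (\<Sum>m\<in>{-2 * int N..2 * int N}. tent N (m + h) * tent N m)"
    unfolding weyl_correlation_def
    by (rule order.trans[OF norm_sum]) (simp add: norm_mult abs_of_nonneg[OF tent_nonneg])
  also have "\<dots> \<le> (\<Sum>m\<in>{-2 * int N..2 * int N}. 2 * 2)"
    by (intro sum_mono mult_mono tent_le_2 tent_nonneg) auto
  also have "\<dots> \<le> 24 * real N" using assms by simp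
  finally show ?thesis .
qed

lemma norm_weyl_correlation_mult_le:
  assumes "N > 0"
  shows "norm (weyl_correlation N t h) * (norm (unit_exp (2 * of_int h * t) - 1))\<^sup>2 \<le> 24 / real N"
  unfolding weyl_correlation_def
  by (rule order.trans[OF norm_sum_unit_exp_second_difference sum_abs_tent_product_second_diff_le])
     (use assms in \<open>auto simp: tent_eq_0\<close>)

text \<open>Each \<open>h\<close> costs at most \<open>24 min N (q^2 / (N r^2))\<close>, where
  \<open>r\<close> is the least absolute remainder of \<open>2 h a\<close> modulo \<open>q\<close>.
  Distinct \<open>h\<close> have distinct \<open>r\<close>, so the sum over \<open>h\<close> is at
  most the sum over all remainders, \<open>24 (q + 2 (4 q)) = 216 q\<close>.\<close>

lemma norm_weyl_sum_le:
  fixes a :: int and q N :: nat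
  assumes "N > 0" "16 * N < q" "coprime a (int q)" "\<bar>t - of_int a / real q\<bar> \<le> 1 / (real q)\<^sup>2"
  shows "(norm (weyl_sum N x t))\<^sup>2 \<le> 216 * real q"
proof -
  let ?J = "{-4 * int N..4 * int N}"
  define l where "l h = round (of_int (2 * h * a) / real q)" for h
  define r where "r h = 2 * h * a - int q * l h" for h
  \<comment> \<open>The value at 0 is set separately: there the quotient would be a division by
    zero, hence 0, and \<open>min\<close> would give the false bound 0.\<close>
  define \<beta> where "\<beta> k = (if k = 0 then real N else min (real N) ((real q)\<^sup>2 / (real N * (of_int k)\<^sup>2)))" for k :: int
  have q: "real q > 0" using assms by simp
  have r_le: "\<bar>of_int (r h)\<bar> \<le> real q / 2" for h
  proof -
    have "of_int (r h) = real q * (of_int (2 * h * a) / real q - of_int (l h))"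
      using q by (simp add: r_def right_diff_distrib)
    then have "\<bar>of_int (r h)\<bar> = real q * \<bar>of_int (2 * h * a) / real q - of_int (l h)\<bar>"
      using q by (simp only: abs_mult abs_of_nonneg)
    also have "\<dots> \<le> real q * (1 / 2)"
      using of_int_round_abs_le[of "of_int (2 * h * a) / real q"] q
      by (intro mult_left_mono) (auto simp: l_def abs_minus_commute)
    finally show ?thesis by simp
  qed
  \<comment> \<open>The residues \<open>2 h a mod q\<close> are distinct, as \<open>|2 (h - h')| \<le> 16 N < q\<close>.\<close>
  have inj: "inj_on r ?J"
  proof
    fix h h' assume h: "h \<in> ?J" "h' \<in> ?J" "r h = r h'"
    then have "a * (2 * (h - h')) = int q * (l h - l h')" by (simp add: r_def algebra_simps)
    then have "int q dvd a * (2 * (h - h'))" by simp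
    then have "int q dvd 2 * (h - h')"
      using assms(3) by (simp add: coprime_commute coprime_dvd_mult_right_iff)
    moreover have "\<bar>2 * (h - h')\<bar> < int q" using h assms(2) by auto
    ultimately show "h = h'" using zdvd_imp_le[of "int q" "\<bar>2 * (h - h')\<bar>"] by auto
  qed
  have bound: "norm (weyl_correlation N t h) \<le> 24 * \<beta> (r h)" if h: "h \<in> ?J" for h
  proof (cases "r h = 0")
    case True
    then show ?thesis using norm_weyl_correlation_le[OF assms(1)] by (simp add: \<beta>_def)
  next
    case False
    define y where "y = 2 * of_int h * t - of_int (l h)"
    define \<eta> where "\<eta> = 2 * of_int h * (t - of_int a / real q)"
    have y: "y = of_int (r h) / real q + \<eta>"
      using q by (simp add: y_def \<eta>_def r_def field_simps)
    have "\<bar>\<eta>\<bar> = 2 * \<bar>of_int h\<bar> * \<bar>t - of_int a / real q\<bar>" by (simp add: \<eta>_def abs_mult)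
    \<comment> \<open>By \<open>|h| <= 4 N\<close> and \<open>16 N < q\<close>. The perturbation
      \<open>\<eta>\<close> is then at most half the gap \<open>1 / q\<close> between residues, so
      it can at most halve \<open>|r h| / q\<close>.\<close>
    also have "\<dots> \<le> (real q / 2) * (1 / (real q)\<^sup>2)"
    proof (intro mult_mono assms(4))
      have "2 * \<bar>h\<bar> \<le> 8 * int N" using h by auto
      then have "2 * \<bar>real_of_int h\<bar> \<le> 8 * real N" by linarith
      also have "\<dots> \<le> real q / 2" using assms(2) by linarith
      finally show "2 * \<bar>real_of_int h\<bar> \<le> real q / 2" .
    qed auto
    also have "\<dots> = 1 / (2 * real q)" using q by (simp add: power2_eq_square)
    finally have \<eta>: "\<bar>\<eta>\<bar> \<le> 1 / (2 * real q)" .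
    have "1 / (2 * real q) \<le> 1 / 10" using assms by (intro divide_left_mono) auto
    moreover have "\<bar>of_int (r h) / real q\<bar> \<le> 1 / 2"
      using r_le[of h] q by (simp add: field_simps)
    ultimately have "\<bar>y\<bar> \<le> 3/5" unfolding y using \<eta> by linarith
    then have "2 * \<bar>y\<bar> \<le> norm (unit_exp y - 1)" by (rule norm_unit_exp_minus_1_ge)
    also have "unit_exp y = unit_exp (2 * of_int h * t)"
      by (rule unit_exp_cong_int) (simp add: y_def)
    finally have 1: "2 * \<bar>y\<bar> \<le> norm (unit_exp (2 * of_int h * t) - 1)" .
    have "\<bar>real_of_int (r h)\<bar> \<ge> 1" using False by linarith
    then have "1 / real q \<le> \<bar>of_int (r h)\<bar> / real q"
      using q by (intro divide_right_mono) auto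
    moreover have "\<bar>of_int (r h) / real q\<bar> = \<bar>of_int (r h)\<bar> / real q" using q by simp
    moreover have "\<bar>\<eta>\<bar> \<le> 1 / real q / 2" using \<eta> by simp
    moreover have "2 * \<bar>u + v\<bar> \<ge> w" if "x \<le> w" "\<bar>u\<bar> = w" "\<bar>v\<bar> \<le> x / 2" for u v w x :: real
      using that abs_triangle_ineq[of "u + v" "- v"] by simp
    ultimately have "2 * \<bar>y\<bar> \<ge> \<bar>of_int (r h)\<bar> / real q" unfolding y by blast
    with 1 have "(\<bar>of_int (r h)\<bar> / real q)\<^sup>2 \<le> (norm (unit_exp (2 * of_int h * t) - 1))\<^sup>2"
      using q by (intro power_mono) auto
    then have "norm (weyl_correlation N t h) * (\<bar>of_int (r h)\<bar> / real q)\<^sup>2 \<le> 24 / real N"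
      by (meson mult_left_mono norm_ge_zero norm_weyl_correlation_mult_le[OF assms(1)] order.trans)
    then have "norm (weyl_correlation N t h) \<le> 24 * ((real q)\<^sup>2 / (real N * (of_int (r h))\<^sup>2))"
      using False q assms(1) by (simp add: field_simps)
    then show ?thesis using norm_weyl_correlation_le[OF assms(1), of t h] False
      by (simp add: \<beta>_def min_def)
  qed
  have \<beta>_nonneg: "\<beta> k \<ge> 0" for k by (simp add: \<beta>_def)
  have "(norm (weyl_sum N x t))\<^sup>2 \<le> (\<Sum>h\<in>?J. 24 * \<beta> (r h))"
    by (rule order.trans[OF norm_weyl_sum_squared_le sum_mono]) (use assms bound in auto)
  also have "\<dots> = 24 * (\<Sum>k\<in>r ` ?J. \<beta> k)" by (simp only: sum_distrib_left sum.reindex[OF inj] comp_def)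
  also have "(\<Sum>k\<in>r ` ?J. \<beta> k) \<le> (\<Sum>k\<in>{-int q..int q}. \<beta> k)"
  proof (rule sum_mono2)
    show "r ` ?J \<subseteq> {-int q..int q}"
    proof (rule image_subsetI)
      fix h
      have "\<bar>real_of_int (r h)\<bar> \<le> real q" using r_le[of h] q by linarith
      then show "r h \<in> {-int q..int q}" by auto
    qed
  qed (auto simp: \<beta>_nonneg)
  also have "(\<Sum>k\<in>{-int q..int q}. \<beta> k) = real N + 2 * (\<Sum>k=1..q. min (real N) ((real q)\<^sup>2 / (real N * (real k)\<^sup>2)))"
  proof -
    have "{-int q..int q} = insert 0 ({1..int q} \<union> {-int q..-1})" by auto
    then have "(\<Sum>k\<in>{-int q..int q}. \<beta> k) = \<beta> 0 + ((\<Sum>k\<in>{1..int q}. \<beta> k) + (\<Sum>k\<in>{-int q..-1}. \<beta> k))"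
      by (simp add: sum.union_disjoint)
    also have "(\<Sum>k\<in>{-int q..-1}. \<beta> k) = (\<Sum>k\<in>{1..int q}. \<beta> k)"
      by (rule sum.reindex_bij_witness[of _ uminus uminus]) (auto simp: \<beta>_def)
    also have "(\<Sum>k\<in>{1..int q}. \<beta> k) = (\<Sum>k=1..q. min (real N) ((real q)\<^sup>2 / (real N * (real k)\<^sup>2)))"
      by (rule sum.reindex_bij_witness[of _ int nat]) (auto simp: \<beta>_def)
    finally show ?thesis by (simp add: \<beta>_def)
  qed
  also have "\<dots> \<le> real q + 2 * (4 * real q)"
    using assms by (intro add_mono mult_left_mono sum_min_inverse_square_le) auto
  finally show ?thesis by simp
qed

section \<open>Ramanujan sums and the divisor bound\<close>

definition ramanujan_sum :: "nat \<Rightarrow> int \<Rightarrow> complex" where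
  "ramanujan_sum q k = (\<Sum>a | a < q \<and> coprime a q. unit_exp (of_int k * real a / real q))"

lemma prod_primes_dvd_iff:
  fixes X :: "nat set"
  assumes "finite X" "\<And>p. p \<in> X \<Longrightarrow> prime p"
  shows "\<Prod>X dvd a \<longleftrightarrow> (\<forall>p\<in>X. p dvd a)"
  using assms
proof (induction X rule: finite_induct)
  case (insert p X)
  have "coprime p (\<Prod>X)"
    using insert by (intro prod_coprime_right) (metis insertCI primes_coprime)
  then show ?case using insert by (simp add: divides_mult)  (metis divides_mult dvd_mult_left dvd_mult_right)
qed simp

lemma prime_factors_prod_primes:
  fixes X :: "nat set"
  assumes "finite X" "\<And>p. p \<in> X \<Longrightarrow> prime p"
  shows "prime_factors (\<Prod>X) = X"
proof -
  have "\<Prod>X \<noteq> 0" using assms by (metis not_prime_0 prod_zero_iff)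
  have "p \<in> X" if "prime p" "p dvd \<Prod>X" for p
  proof -
    have "\<exists>p'\<in>X. p dvd p'" using that assms prime_dvd_prod_iff[of X p "\<lambda>x. x"] by auto
    then show ?thesis using that assms by (metis primes_dvd_imp_eq)
  qed
  then show ?thesis using assms \<open>\<Prod>X \<noteq> 0\<close> by (auto simp: in_prime_factors_iff intro: dvd_prodI)
qed

text \<open>Moebius inversion, obtained by expanding the product of
  \<open>1 - of_bool (p dvd a)\<close> over the primes of \<open>q\<close>. Sets of primes stand for
  the squarefree divisors.\<close>

lemma of_bool_coprime_eq_sum:
  fixes a q :: nat
  assumes "q > 0"
  shows "(of_bool (coprime a q) :: complex) = (\<Sum>X\<in>Pow (prime_factors q). (-1) ^ card X * of_bool (\<Prod>X dvd a))"
proof -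
  have cop: "coprime a q \<longleftrightarrow> (\<forall>p\<in>prime_factors q. \<not> p dvd a)"
  proof
    assume "coprime a q"
    then show "\<forall>p\<in>prime_factors q. \<not> p dvd a"
      by (metis coprime_common_divisor_nat in_prime_factors_iff not_prime_1 dvd_refl nat_dvd_1_iff_1)
  next
    assume *: "\<forall>p\<in>prime_factors q. \<not> p dvd a"
    show "coprime a q"
    proof (rule ccontr)
      assume "\<not> coprime a q"
      then have "gcd a q \<noteq> 1" by (simp add: coprime_iff_gcd_eq_1)
      then obtain p where "prime p" "p dvd gcd a q" using prime_factor_nat by blast
      then show False using * assms by (auto simp: in_prime_factors_iff)
    qed
  qed
  have fin: "finite (prime_factors q)" by simp
  have "(of_bool (coprime a q) :: complex) = (\<Prod>p\<in>prime_factors q. 1 - of_bool (p dvd a))"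
  proof (cases "coprime a q")
    case False
    then obtain p where "p \<in> prime_factors q" "p dvd a" unfolding cop by blast
    then have "(\<Prod>p\<in>prime_factors q. 1 - of_bool (p dvd a) :: complex) = 0"
      by (intro prod_zero fin) auto
    then show ?thesis using False by simp
  qed (use cop in simp)
  also have "\<dots> = (\<Sum>X\<in>Pow (prime_factors q). (-1) ^ card X * (\<Prod>p\<in>X. of_bool (p dvd a)) * (\<Prod>p\<in>prime_factors q - X. 1))"
    by (rule prod_diff_conv_sum) simp
  also have "\<dots> = (\<Sum>X\<in>Pow (prime_factors q). (-1) ^ card X * of_bool (\<Prod>X dvd a))"
  proof (intro sum.cong refl)
    fix X assume "X \<in> Pow (prime_factors q)"
    then have X: "finite X" "\<And>p. p \<in> X \<Longrightarrow> prime p" using finite_subset[OF _ fin] by auto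
    have "(\<Prod>p\<in>X. of_bool (p dvd a) :: complex) = of_bool (\<forall>p\<in>X. p dvd a)"
      using X(1) by (induction X rule: finite_induct) auto
    then show "(-1) ^ card X * (\<Prod>p\<in>X. of_bool (p dvd a)) * (\<Prod>p\<in>prime_factors q - X. 1)
        = (-1 :: complex) ^ card X * of_bool (\<Prod>X dvd a)"
      using prod_primes_dvd_iff[OF X] by simp
  qed
  finally show ?thesis .
qed

text \<open>For a squarefree \<open>m\<close> dividing \<open>q\<close>, the sum over the multiples
  of \<open>m\<close> is a complete sum: it is \<open>q / m\<close> if \<open>q / m\<close> divides
  \<open>k\<close>, and 0 otherwise. Different \<open>m\<close> give different common divisors
  \<open>d = q / m\<close> of \<open>q\<close> and \<open>k\<close>.\<close>

lemma norm_ramanujan_sum_le: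
  assumes "q > 0"
  shows "norm (ramanujan_sum q k) \<le> (\<Sum>d | d dvd q \<and> int d dvd k. real d)"
proof -
  let ?P = "Pow (prime_factors q)"
  let ?e = "\<lambda>a. unit_exp (of_int k * real a / real q)"
  have fin: "finite (prime_factors q)" by simp
  have prod_dvd: "\<Prod>X dvd q" "\<Prod>X > 0" if "X \<in> ?P" for X
  proof -
    have X: "finite X" "\<And>p. p \<in> X \<Longrightarrow> prime p" using that finite_subset[OF _ fin] by auto
    show "\<Prod>X dvd q" using that by (subst prod_primes_dvd_iff[OF X]) (auto simp: in_prime_factors_iff)
    then show "\<Prod>X > 0" using assms by (meson dvd_pos_nat)
  qed
  have inner: "norm (\<Sum>a<q. of_bool (m dvd a) * ?e a) = of_bool (int (q div m) dvd k) * real (q div m)"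
    if m: "m dvd q" for m
  proof -
    obtain r where r: "q = m * r" using m by blast
    have pos: "m > 0" "r > 0" using assms r by auto
    have "(\<Sum>a<q. of_bool (m dvd a) * ?e a) = (\<Sum>a\<in>{a. a < q \<and> m dvd a}. ?e a)"
      by (simp add: of_bool_def if_distrib[of "\<lambda>x. x * _"] sum.If_cases Int_def lessThan_def cong: if_cong)
    also have "\<dots> = (\<Sum>b\<in>{0..<0 + int r}. unit_exp (of_int b * of_int k / real r))"
    proof (rule sum.reindex_bij_witness[of _ "\<lambda>b. m * nat b" "\<lambda>a. int (a div m)"])
      fix a assume "a \<in> {a. a < q \<and> m dvd a}"
      then obtain b where "a = m * b" "b < r" using r pos by auto
      then show "unit_exp (of_int (int (a div m)) * of_int k / real r) = ?e a" "int (a div m) \<in> {0..<0 + int r}"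
        "m * nat (int (a div m)) = a"
        using pos r by (auto simp: mult.commute)
    qed (use pos r in auto)
    also have "\<dots> = (if int r dvd k then of_nat r else 0)"
      by (rule sum_unit_exp_multiples) (use pos in simp)
    finally show ?thesis using r pos by simp
  qed
  have "ramanujan_sum q k = (\<Sum>a<q. of_bool (coprime a q) * ?e a)"
    unfolding ramanujan_sum_def
    by (simp add: of_bool_def if_distrib[of "\<lambda>x. x * _"] sum.If_cases Int_def lessThan_def cong: if_cong)
  also have "\<dots> = (\<Sum>a<q. \<Sum>X\<in>?P. (-1) ^ card X * (of_bool (\<Prod>X dvd a) * ?e a))"
    unfolding of_bool_coprime_eq_sum[OF assms] sum_distrib_right by (simp only: mult.assoc)
  also have "\<dots> = (\<Sum>X\<in>?P. (-1) ^ card X * (\<Sum>a<q. of_bool (\<Prod>X dvd a) * ?e a))"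
    by (subst sum.swap) (simp only: sum_distrib_left)
  finally have "norm (ramanujan_sum q k) \<le> (\<Sum>X\<in>?P. norm (\<Sum>a<q. of_bool (\<Prod>X dvd a) * ?e a))"
    by (simp only:) (rule order.trans[OF norm_sum], simp add: norm_mult norm_power)
  also have "\<dots> = (\<Sum>X\<in>?P. of_bool (int (q div \<Prod>X) dvd k) * real (q div \<Prod>X))"
    by (intro sum.cong refl inner prod_dvd)
  also have "\<dots> = (\<Sum>X | X \<in> ?P \<and> int (q div \<Prod>X) dvd k. real (q div \<Prod>X))"
    by (simp add: of_bool_def if_distrib[of "\<lambda>x. x * _"] sum.If_cases Int_def cong: if_cong)
  also have "\<dots> = (\<Sum>d\<in>(\<lambda>X. q div \<Prod>X) ` {X \<in> ?P. int (q div \<Prod>X) dvd k}. real d)"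
  proof (subst sum.reindex)
    show "inj_on (\<lambda>X. q div \<Prod>X) {X \<in> ?P. int (q div \<Prod>X) dvd k}"
    proof (rule inj_onI)
      fix X Y assume X: "X \<in> {X \<in> ?P. int (q div \<Prod>X) dvd k}" and Y: "Y \<in> {X \<in> ?P. int (q div \<Prod>X) dvd k}"
        and eq: "q div \<Prod>X = q div \<Prod>Y"
      have "\<Prod>X = \<Prod>Y" using prod_dvd[of X] prod_dvd[of Y] X Y eq assms
        by (metis (no_types, lifting) dvd_div_eq_0_iff dvd_mult_div_cancel mem_Collect_eq mult_cancel2 not_gr_zero)
      moreover have "finite X" "\<And>p. p \<in> X \<Longrightarrow> prime p" "finite Y" "\<And>p. p \<in> Y \<Longrightarrow> prime p"
        using X Y finite_subset[OF _ fin] by auto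
      ultimately show "X = Y" by (metis prime_factors_prod_primes)
    qed
  qed simp
  also have "\<dots> \<le> (\<Sum>d | d dvd q \<and> int d dvd k. real d)"
  proof (rule sum_mono2)
    show "finite {d. d dvd q \<and> int d dvd k}" using assms by simp
    show "(\<lambda>X. q div \<Prod>X) ` {X \<in> ?P. int (q div \<Prod>X) dvd k} \<subseteq> {d. d dvd q \<and> int d dvd k}"
      using prod_dvd assms by (auto simp: div_dvd_iff_mult)
  qed auto
  finally show ?thesis .
qed

section \<open>The divisor bound\<close>

definition num_divisors :: "nat \<Rightarrow> nat" where
  "num_divisors k = card {d. d dvd k}"

text \<open>A divisor is determined by its exponents at the primes of \<open>k\<close>, and these
  are at most the exponents in \<open>k\<close>.\<close>

lemma num_divisors_le_prod:
  assumes "k > 0"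
  shows "num_divisors k \<le> (\<Prod>p\<in>prime_factors k. multiplicity p k + 1)"
proof -
  let ?f = "\<lambda>d. \<lambda>p\<in>prime_factors k. multiplicity p d"
  have "inj_on ?f {d. d dvd k}"
  proof (rule inj_onI)
    fix d d' assume d: "d \<in> {d. d dvd k}" "d' \<in> {d. d dvd k}" and eq: "?f d = ?f d'"
    have pos: "d > 0" "d' > 0" using d assms by (auto intro: dvd_pos_nat)
    show "d = d'"
    proof (rule multiplicity_eq_nat[OF pos])
      fix p :: nat assume p: "prime p"
      show "multiplicity p d = multiplicity p d'"
      proof (cases "p dvd k")
        case True
        then have "p \<in> prime_factors k" using p assms by (simp add: in_prime_factors_iff)
        then show ?thesis using fun_cong[OF eq, of p] by simp
      next
        case False
        then have "\<not> p dvd d" "\<not> p dvd d'" using d by (auto dest: dvd_trans)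
        then show ?thesis by (simp add: not_dvd_imp_multiplicity_0)
      qed
    qed
  qed
  moreover have "?f ` {d. d dvd k} \<subseteq> (\<Pi>\<^sub>E p\<in>prime_factors k. {0..multiplicity p k})"
    using assms by (auto intro!: dvd_imp_multiplicity_le)
  moreover have "finite (\<Pi>\<^sub>E p\<in>prime_factors k. {0..multiplicity p k})" by (intro finite_PiE) auto
  ultimately have "num_divisors k \<le> card (\<Pi>\<^sub>E p\<in>prime_factors k. {0..multiplicity p k})"
    unfolding num_divisors_def by (metis card_inj_on_le)
  then show ?thesis by (simp add: card_PiE)
qed

text \<open>Compare prime by prime. If \<open>p >= 2 powr (1 / \<epsilon>)\<close>, then
  \<open>a + 1 <= 2^a <= (p powr \<epsilon>)^a\<close>. The finitely many smaller primes, collected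
  in \<open>S\<close>, lose a factor \<open>K\<close> each, so
  \<open>C = K ^ card S\<close>.\<close>

lemma num_divisors_bound:
  assumes "\<epsilon> > 0"
  obtains C :: real where "C > 0" "\<And>k. k > 0 \<Longrightarrow> real (num_divisors k) \<le> C * real k powr \<epsilon>"
proof -
  \<comment> \<open>Since \<open>(2 powr \<epsilon>)^a >= 1 + a \<epsilon> ln 2\<close>,
    multiplication by \<open>K\<close> yields at least \<open>1 + a\<close> once
    \<open>K >= 1\<close> and \<open>K \<epsilon> ln 2 >= 1\<close>.\<close>
  define K where "K = max 1 (1 / (\<epsilon> * ln 2))"
  define S where "S = {p. prime p \<and> real p < 2 powr (1 / \<epsilon>)}"
  have "S \<subseteq> {..nat \<lceil>2 powr (1 / \<epsilon>)\<rceil>}" unfolding S_def by (auto simp: le_nat_iff) linarith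
  then have finS: "finite S" by (rule finite_subset) simp
  have K: "K \<ge> 1" by (simp add: K_def)
  have local_bound: "real (a + 1) \<le> (if p \<in> S then K else 1) * (real p powr \<epsilon>) ^ a" if p: "prime p" for p a
  proof (cases "p \<in> S")
    case True
    have "2 powr \<epsilon> \<le> real p powr \<epsilon>"
      using assms prime_ge_2_nat[OF p] by (intro powr_mono2) auto
    then have "(2 powr \<epsilon>) ^ a \<le> (real p powr \<epsilon>) ^ a" by (intro power_mono) auto
    moreover have "(2 powr \<epsilon>) ^ a = exp (real a * (\<epsilon> * ln 2))"
      by (simp add: powr_def exp_of_nat_mult)
    moreover have "1 + real a * (\<epsilon> * ln 2) \<le> exp (real a * (\<epsilon> * ln 2))" by (rule exp_ge_add_one_self)
    ultimately have "K * (1 + real a * (\<epsilon> * ln 2)) \<le> K * (real p powr \<epsilon>) ^ a"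
      using K by (intro mult_left_mono) linarith+
    moreover have "real a * 1 \<le> real a * (K * (\<epsilon> * ln 2))"
    proof (intro mult_left_mono)
      have pos: "\<epsilon> * ln 2 > 0" using assms by simp
      have "1 / (\<epsilon> * ln 2) \<le> K" unfolding K_def by linarith
      then show "1 \<le> K * (\<epsilon> * ln 2)" using pos by (simp only: pos_divide_le_eq)
    qed simp
    ultimately show ?thesis using True K by (simp add: algebra_simps)
  next
    case False
    then have "2 powr (1 / \<epsilon>) \<le> real p" using p by (simp add: S_def)
    then have "(2 powr (1 / \<epsilon>)) powr \<epsilon> \<le> real p powr \<epsilon>" using assms by (intro powr_mono2) auto
    then have "2 \<le> real p powr \<epsilon>" using assms by (simp add: powr_powr)
    then have "2 ^ a \<le> (real p powr \<epsilon>) ^ a" by (intro power_mono) auto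
    moreover have "real (a + 1) \<le> 2 ^ a" by (induction a) auto
    ultimately show ?thesis using False by simp
  qed
  have "real (num_divisors k) \<le> K ^ card S * real k powr \<epsilon>" if k: "k > 0" for k
  proof -
    have "real (num_divisors k) \<le> (\<Prod>p\<in>prime_factors k. real (multiplicity p k + 1))"
      using num_divisors_le_prod[OF k] by (metis of_nat_le_iff of_nat_prod)
    also have "\<dots> \<le> (\<Prod>p\<in>prime_factors k. (if p \<in> S then K else 1) * (real p powr \<epsilon>) ^ multiplicity p k)"
      by (intro prod_mono conjI local_bound) auto
    also have "\<dots> = (\<Prod>p\<in>prime_factors k. if p \<in> S then K else 1) * (\<Prod>p\<in>prime_factors k. real p ^ multiplicity p k) powr \<epsilon>"
    proof -
      have "(real p ^ n) powr \<epsilon> = (real p powr \<epsilon>) ^ n" for p n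
        by (induction n) (simp_all add: powr_mult)
      then show ?thesis by (simp add: prod.distrib prod_powr_distrib)
    qed
    also have "(\<Prod>p\<in>prime_factors k. real p ^ multiplicity p k) = real k"
      using prime_factorization_nat[of k] k by (metis (no_types, lifting) of_nat_prod of_nat_power prod.cong)
    also have "(\<Prod>p\<in>prime_factors k. if p \<in> S then K else 1) = K ^ card (prime_factors k \<inter> S)"
      by (simp add: prod.If_cases)
    also have "\<dots> \<le> K ^ card S" using finS K by (intro power_increasing card_mono) auto
    finally show ?thesis by (simp add: mult_right_mono)
  qed
  moreover have "K ^ card S > 0" using K by simp
  ultimately show ?thesis using that by blast
qed

section \<open>Farey fractions and the minor arc multiplier\<close>

text \<open>The lower limit on \<open>q\<close> later turns \<open>64 N <= n\<close> into the
  hypothesis \<open>16 N < q\<close> of Weyl's inequality.\<close>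

definition farey_pairs :: "nat \<Rightarrow> (nat \<times> nat) set" where
  "farey_pairs n = (SIGMA q : {q. n < 4 * q \<and> q \<le> n}. {a. a < q \<and> coprime a q})"

lemma finite_farey_pairs: "finite (farey_pairs n)"
proof -
  have "finite {q. n < 4 * q \<and> q \<le> n}" by (rule finite_subset[of _ "{..n}"]) auto
  then show ?thesis by (auto simp: farey_pairs_def)
qed

lemma card_triangle_pairs: "2 * card (SIGMA q : {..m}. {0<..<q}) = m * (m - 1)" for m :: nat
  by (induction m) (auto simp: algebra_simps)

text \<open>Telescoping against \<open>1 / ((d - 1) d)\<close>, with the term \<open>d = 2\<close>
  kept exact. Telescoping from the start would give the bound 1, too large for a positive proportion
  of coprime pairs to remain.\<close>

lemma sum_inverse_squares_le: "n \<ge> 2 \<Longrightarrow> (\<Sum>d=2..n. 1 / (real d)\<^sup>2) \<le> 3 / 4 - 1 / real n"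
proof (induction n rule: nat_induct_at_least)
  case (Suc n)
  have "1 / (real (Suc n))\<^sup>2 \<le> 1 / (real n * real (Suc n))"
    using Suc.hyps by (intro divide_left_mono) (auto simp: power2_eq_square intro!: mult_right_mono)
  also have "\<dots> = 1 / real n - 1 / real (Suc n)"
    using Suc.hyps by (simp add: field_simps)
  finally show ?case using Suc by simp
qed simp

text \<open>Of the roughly \<open>n^2 / 2\<close> pairs \<open>a < q <= n\<close>, a positive
  proportion survives the removal of those with a common factor and those with
  \<open>q <= n / 4\<close>.\<close>

lemma card_farey_pairs_ge:
  assumes "n \<ge> 8"
  shows "(real n)\<^sup>2 \<le> 32 * real (card (farey_pairs n))"
proof -
  define T where "T m = (SIGMA q : {..m}. {0<..<q})" for m :: nat
  have fin: "finite (T m)" for m by (simp add: T_def)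
  have le: "real (card (T m)) \<le> (real m)\<^sup>2 / 2" for m
  proof -
    have "2 * card (T m) \<le> m\<^sup>2"
      unfolding T_def card_triangle_pairs by (simp add: power2_eq_square)
    then have "real (2 * card (T m)) \<le> real (m\<^sup>2)" by (simp only: of_nat_le_iff)
    then show ?thesis by simp
  qed
  have le_div: "real (card (T (n div d))) \<le> (real n)\<^sup>2 / 2 * (1 / (real d)\<^sup>2)" for d
  proof -
    have "(real (n div d))\<^sup>2 \<le> (real n / real d)\<^sup>2"
      by (intro power_mono of_nat_div_le_of_nat) auto
    then show ?thesis using le[of "n div d"] by (simp add: power_divide)
  qed
  \<comment> \<open>A pair with gcd \<open>d \<ge> 2\<close> is \<open>d\<close> times a pair in \<open>T (n div d)\<close>, and \<open>\<Sum> 1 / d\<^sup>2 \<le> 3 / 4\<close> over \<open>d \<ge> 2\<close>.\<close>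
  have "T n \<subseteq> farey_pairs n \<union> (T (n div 4) \<union> (\<Union>d\<in>{2..n}. (\<lambda>(q, a). (d * q, d * a)) ` T (n div d)))"
  proof
    fix z assume "z \<in> T n"
    then obtain q a where z: "z = (q, a)" "0 < a" "a < q" "q \<le> n" by (auto simp: T_def)
    show "z \<in> farey_pairs n \<union> (T (n div 4) \<union> (\<Union>d\<in>{2..n}. (\<lambda>(q, a). (d * q, d * a)) ` T (n div d)))"
    proof (cases "coprime a q")
      case True
      then show ?thesis using z by (auto simp: T_def farey_pairs_def)
    next
      case False
      define d where "d = gcd a q"
      obtain a' q' where aq: "a = d * a'" "q = d * q'" unfolding d_def by (meson gcd_dvd1 gcd_dvd2 dvdE)
      have d: "d \<noteq> 0" "d \<noteq> 1" "d \<le> n"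
        using False z by (auto simp: d_def coprime_iff_gcd_eq_1 intro: le_trans[OF gcd_le2_nat])
      then have "q' \<le> n div d" using z aq by (simp add: less_eq_div_iff_mult_less_eq mult.commute)
      then have "(q', a') \<in> T (n div d)" using z aq d by (auto simp: T_def)
      then have "z \<in> (\<lambda>(q, a). (d * q, d * a)) ` T (n div d)" using z aq by force
      then show ?thesis using d by auto
    qed
  qed
  then have "card (T n) \<le> card (farey_pairs n \<union> (T (n div 4) \<union> (\<Union>d\<in>{2..n}. (\<lambda>(q, a). (d * q, d * a)) ` T (n div d))))"
    by (intro card_mono) (auto simp: fin finite_farey_pairs)
  also have "\<dots> \<le> card (farey_pairs n) + (card (T (n div 4)) + card (\<Union>d\<in>{2..n}. (\<lambda>(q, a). (d * q, d * a)) ` T (n div d)))"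
    by (rule order.trans[OF card_Un_le add_left_mono[OF card_Un_le]])
  also have "card (\<Union>d\<in>{2..n}. (\<lambda>(q, a). (d * q, d * a)) ` T (n div d)) \<le> (\<Sum>d=2..n. card (T (n div d)))"
    by (rule order.trans[OF card_UN_le]) (auto intro!: sum_mono card_image_le fin)
  finally have "real (card (T n)) \<le> real (card (farey_pairs n)) + (real (card (T (n div 4))) + (\<Sum>d=2..n. real (card (T (n div d)))))"
    by (simp flip: of_nat_sum of_nat_add)
  also have "(\<Sum>d=2..n. real (card (T (n div d)))) \<le> (\<Sum>d=2..n. (real n)\<^sup>2 / 2 * (1 / (real d)\<^sup>2))"
    by (intro sum_mono le_div)
  also have "\<dots> = (real n)\<^sup>2 / 2 * (\<Sum>d=2..n. 1 / (real d)\<^sup>2)" by (simp only: sum_distrib_left)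
  also have "\<dots> \<le> (real n)\<^sup>2 / 2 * (3 / 4)"
  proof (intro mult_left_mono)
    have "1 / real n \<ge> 0" by simp
    then show "(\<Sum>d=2..n. 1 / (real d)\<^sup>2) \<le> 3 / 4" using sum_inverse_squares_le[of n] assms by linarith
  qed simp
  also have "real (card (T (n div 4))) \<le> (real n)\<^sup>2 / 2 * (1 / (real 4)\<^sup>2)" by (rule le_div)
  \<comment> \<open>Here \<open>13/32 = (3/4 + 1/16) / 2\<close>. Subtracted from
    \<open>n^2 / 2 - n / 2\<close> this leaves \<open>3/32 n^2 - n / 2\<close>, and
    \<open>n / 2 <= n^2 / 16\<close> by \<open>n >= 8\<close>.\<close>
  finally have 1: "real (card (T n)) \<le> real (card (farey_pairs n)) + (real n)\<^sup>2 * (13 / 32)" by simp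
  have "2 * card (T n) = n * (n - 1)" unfolding T_def by (rule card_triangle_pairs)
  then have "2 * real (card (T n)) = real n * real (n - 1)" by (metis of_nat_mult of_nat_numeral)
  then have "2 * real (card (T n)) = (real n)\<^sup>2 - real n"
    using assms by (simp add: of_nat_diff power2_eq_square algebra_simps)
  moreover have "(real n)\<^sup>2 \<ge> 8 * real n" using assms by (simp add: power2_eq_square)
  ultimately show ?thesis using 1 by linarith
qed

text \<open>Summing the bound for Ramanujan sums over \<open>q\<close> and exchanging sums, a
  divisor \<open>d\<close> of \<open>k\<close> is counted once for each multiple up to
  \<open>n\<close>, in total \<open>d (n div d) <= n\<close>.\<close>

lemma norm_sum_farey_pairs_le:
  assumes "k \<noteq> 0"
  shows "norm (\<Sum>(q, a)\<in>farey_pairs n. unit_exp (of_int k * real a / real q)) \<le> real n * real (num_divisors (nat \<bar>k\<bar>))"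
proof -
  have dvd_iff: "int d dvd k \<longleftrightarrow> d dvd nat \<bar>k\<bar>" for d
    by (metis int_dvd_int_iff int_nat_eq abs_ge_zero dvd_abs_iff)
  have finD: "finite {d. d dvd nat \<bar>k\<bar>}" using assms by (intro finite_divisors_nat) simp
  have finq: "finite {q. n < 4 * q \<and> q \<le> n}" by (rule finite_subset[of _ "{..n}"]) auto
  have "(\<Sum>(q, a)\<in>farey_pairs n. unit_exp (of_int k * real a / real q)) = (\<Sum>q | n < 4 * q \<and> q \<le> n. ramanujan_sum q k)"
    unfolding farey_pairs_def ramanujan_sum_def by (subst sum.Sigma) (auto simp: finq)
  then have "norm (\<Sum>(q, a)\<in>farey_pairs n. unit_exp (of_int k * real a / real q)) \<le> (\<Sum>q | n < 4 * q \<and> q \<le> n. norm (ramanujan_sum q k))"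
    by (simp add: norm_sum)
  also have "\<dots> \<le> (\<Sum>q | n < 4 * q \<and> q \<le> n. \<Sum>d | d dvd q \<and> int d dvd k. real d)"
    by (intro sum_mono norm_ramanujan_sum_le) auto
  also have "\<dots> \<le> (\<Sum>q=1..n. \<Sum>d | d dvd q \<and> int d dvd k. real d)"
    by (intro sum_mono2) (auto intro: sum_nonneg)
  also have "\<dots> = (\<Sum>q=1..n. \<Sum>d | d dvd nat \<bar>k\<bar>. if d dvd q then real d else 0)"
  proof (rule sum.cong[OF refl])
    fix q
    have "{d. d dvd q \<and> int d dvd k} = {d. d dvd nat \<bar>k\<bar>} \<inter> {d. d dvd q}"
      using dvd_iff by blast
    then show "(\<Sum>d | d dvd q \<and> int d dvd k. real d) = (\<Sum>d | d dvd nat \<bar>k\<bar>. if d dvd q then real d else 0)"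
      by (simp only: sum.If_cases[OF finD] sum.neutral_const add_0_right)
  qed
  also have "\<dots> = (\<Sum>d | d dvd nat \<bar>k\<bar>. \<Sum>q=1..n. if d dvd q then real d else 0)" by (rule sum.swap)
  also have "\<dots> \<le> (\<Sum>d | d dvd nat \<bar>k\<bar>. real n)"
  proof (intro sum_mono)
    fix d assume "d \<in> {d. d dvd nat \<bar>k\<bar>}"
    then have d: "d > 0" using assms by (auto intro!: Nat.gr0I)
    have "(\<Sum>q=1..n. if d dvd q then real d else 0) = real (card ({1..n} \<inter> {q. d dvd q})) * real d"
      by (simp add: sum.If_cases)
    also have "card ({1..n} \<inter> {q. d dvd q}) \<le> card ((\<lambda>m. d * m) ` {1..n div d})"
    proof (rule card_mono)
      show "{1..n} \<inter> {q. d dvd q} \<subseteq> (\<lambda>m. d * m) ` {1..n div d}"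
      proof
        fix q assume "q \<in> {1..n} \<inter> {q. d dvd q}"
        then obtain m where "q = d * m" "1 \<le> q" "q \<le> n" by auto
        then have "m \<in> {1..n div d}" using d by (auto simp: less_eq_div_iff_mult_less_eq mult.commute)
        then show "q \<in> (\<lambda>m. d * m) ` {1..n div d}" unfolding \<open>q = d * m\<close> by (rule imageI)
      qed
    qed simp
    also have "\<dots> \<le> n div d" using card_image_le[of "{1..n div d}" "\<lambda>m. d * m"] by simp
    also have "real (n div d) * real d \<le> real n" by (simp flip: of_nat_mult)
    finally show "(\<Sum>q=1..n. if d dvd q then real d else 0) \<le> real n" by (simp add: mult_right_mono)
  qed
  also have "\<dots> = real n * real (num_divisors (nat \<bar>k\<bar>))" by (simp add: num_divisors_def)
  finally show ?thesis .
qed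

text \<open>The difference is a nonzero integer over \<open>q q' <= n^2\<close>. The integer
  \<open>l\<close> makes this a distance on the circle.\<close>

lemma farey_pairs_separated:
  assumes "(q, a) \<in> farey_pairs n" "(q', a') \<in> farey_pairs n" "(q, a) \<noteq> (q', a')"
  shows "\<bar>real a / real q - real a' / real q' - of_int l\<bar> \<ge> 1 / (real n)\<^sup>2"
proof -
  have q: "0 < q" "q \<le> n" "a < q" "coprime a q" "0 < q'" "q' \<le> n" "a' < q'" "coprime a' q'"
    using assms by (auto simp: farey_pairs_def)
  define z where "z = int a * int q' - int a' * int q - l * int q * int q'"
  have eq: "real a / real q - real a' / real q' - of_int l = of_int z / (real q * real q')"
    using q by (simp add: z_def field_simps)
  have "z \<noteq> 0"
  proof
    assume "z = 0"
    then have 0: "real a / real q - real a' / real q' = of_int l" using eq by simp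
    have "0 \<le> real a / real q" "real a / real q < 1" "0 \<le> real a' / real q'" "real a' / real q' < 1"
      using q by auto
    then have "-1 < real_of_int l" "real_of_int l < 1" using 0 by linarith+
    then have "l = 0" by linarith
    with \<open>z = 0\<close> have "int a * int q' = int a' * int q" by (simp add: z_def)
    then have "a * q' = a' * q" by (metis of_nat_eq_iff of_nat_mult)
    then have "a = a' \<and> q' = q"
      using coprime_crossproduct_nat[of a q a' q'] q by (simp add: mult.commute)
    with assms show False by simp
  qed
  then have "1 \<le> \<bar>real_of_int z\<bar>" by linarith
  moreover have "real q * real q' \<le> (real n)\<^sup>2" "real q * real q' > 0"
    using q by (auto simp: power2_eq_square intro: mult_mono)
  ultimately have "1 / (real n)\<^sup>2 \<le> \<bar>real_of_int z\<bar> / (real q * real q')"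
    by (intro frac_le) auto
  then show ?thesis unfolding eq by (simp add: abs_mult)
qed

section \<open>Triangular bumps modulo \<open>M\<close> and their Fourier coefficients\<close>

definition dirichlet_sum :: "nat \<Rightarrow> nat \<Rightarrow> int \<Rightarrow> complex" where
  "dirichlet_sum M L k = (\<Sum>u<L. unit_exp (of_int k * real u / real M))"

lemma norm_dirichlet_sum_le: "norm (dirichlet_sum M L k) \<le> real L"
  unfolding dirichlet_sum_def by (rule order.trans[OF norm_sum]) simp

text \<open>Geometric series: the product with \<open>w - 1\<close> has norm at most 2, while
  \<open>|w - 1| >= 2 |k| / M\<close> because \<open>|k / M| <= 1/2\<close>.\<close>

lemma norm_dirichlet_sum_mult_le:
  assumes "M > 0" "2 * \<bar>k\<bar> \<le> int M"
  shows "norm (dirichlet_sum M L k) * \<bar>of_int k\<bar> \<le> real M"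
proof -
  define w where "w = unit_exp (of_int k / real M)"
  have D: "dirichlet_sum M L k = (\<Sum>u<L. w ^ u)"
    by (simp add: dirichlet_sum_def w_def unit_exp_power mult.commute)
  have k: "\<bar>of_int k / real M\<bar> = \<bar>of_int k\<bar> / real M" by simp
  have "real_of_int (2 * \<bar>k\<bar>) \<le> real M" using assms(2) by linarith
  then have "\<bar>of_int k\<bar> / real M \<le> 1 / 2" using assms(1) by (simp add: field_simps)
  then have "2 * (\<bar>of_int k\<bar> / real M) \<le> norm (w - 1)"
    using norm_unit_exp_minus_1_ge[of "of_int k / real M"] k unfolding w_def by linarith
  then have "norm (dirichlet_sum M L k) * (2 * (\<bar>of_int k\<bar> / real M)) \<le> norm (dirichlet_sum M L k) * norm (w - 1)"
    by (intro mult_left_mono) auto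
  also have "\<dots> = norm ((w - 1) * (\<Sum>u<L. w ^ u))" by (simp add: D norm_mult mult.commute)
  also have "(w - 1) * (\<Sum>u<L. w ^ u) = w ^ L - 1" by (rule power_diff_1_eq[symmetric])
  also have "norm (w ^ L - 1) \<le> norm (w ^ L) + norm (1::complex)" by (rule norm_triangle_ineq4)
  also have "\<dots> = 2" by (simp add: norm_power w_def)
  finally show ?thesis using assms(1) by (simp add: field_simps)
qed

text \<open>The autocorrelation modulo \<open>M\<close> of the indicator of \<open>{..<L}\<close>, a
  discrete form of the Fejer kernel's triangle. As a convolution square it has the nonnegative
  Fourier coefficients \<open>|dirichlet_sum|^2\<close>, which decay like inverse squares.\<close>

definition bump :: "nat \<Rightarrow> nat \<Rightarrow> int \<Rightarrow> nat" where
  "bump M L y = card {(u, v). u < L \<and> v < L \<and> int M dvd y - (int u - int v)}"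

lemma bump_pos_imp:
  assumes "bump M L y > 0"
  obtains l where "\<bar>y - l * int M\<bar> < int L"
proof -
  have "{(u, v). u < L \<and> v < L \<and> int M dvd y - (int u - int v)} \<noteq> {}"
    using assms unfolding bump_def by force
  then obtain u v l where "u < L" "v < L" "y - (int u - int v) = int M * l" by (auto elim!: dvdE)
  then have "\<bar>y - l * int M\<bar> < int L" by (simp add: algebra_simps)
  then show ?thesis using that by blast
qed

lemma bump_le:
  assumes "L \<le> M"
  shows "bump M L y \<le> L"
proof -
  let ?A = "{(u, v). u < L \<and> v < L \<and> int M dvd y - (int u - int v)}"
  have "inj_on snd ?A"
  proof (rule inj_onI, clarsimp)
    fix u u' v assume *: "u < L" "u' < L" "int M dvd y - (int u - int v)" "int M dvd y - (int u' - int v)"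
    have "int M dvd (y - (int u - int v)) - (y - (int u' - int v))" by (rule dvd_diff[OF *(3,4)])
    then have "int M dvd int u' - int u" by simp
    moreover have "\<bar>int u' - int u\<bar> < int M" using * assms by auto
    ultimately show "u = u'" using zdvd_imp_le[of "int M" "\<bar>int u' - int u\<bar>"] by auto
  qed
  moreover have "snd ` ?A \<subseteq> {..<L}" by auto
  ultimately have "card ?A \<le> card {..<L}" by (intro card_inj_on_le) auto
  then show ?thesis by (simp add: bump_def)
qed

lemma bump_fourier:
  assumes "M > 0"
  shows "of_nat (M * bump M L y)
     = (\<Sum>k\<in>{b..<b + int M}. of_real ((norm (dirichlet_sum M L k))\<^sup>2) * unit_exp (of_int k * of_int y / real M))"
proof -
  let ?K = "{b..<b + int M}"
  have *: "of_real ((norm (dirichlet_sum M L k))\<^sup>2) * unit_exp (of_int k * of_int y / real M)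
     = (\<Sum>(u, v)\<in>{..<L} \<times> {..<L}. unit_exp (of_int k * of_int (y - (int u - int v)) / real M))" for k
  proof -
    have "of_real ((norm (dirichlet_sum M L k))\<^sup>2) = cnj (dirichlet_sum M L k) * dirichlet_sum M L k"
      by (metis complex_norm_square mult.commute)
    also have "\<dots> = (\<Sum>u<L. \<Sum>v<L. unit_exp (- (of_int k * real u / real M)) * unit_exp (of_int k * real v / real M))"
      by (simp add: dirichlet_sum_def sum_product cnj_unit_exp)
    also have "\<dots> * unit_exp (of_int k * of_int y / real M)
      = (\<Sum>u<L. \<Sum>v<L. unit_exp (of_int k * of_int (y - (int u - int v)) / real M))"
      unfolding sum_distrib_right
      by (intro sum.cong refl)
         (simp add: unit_exp_add[symmetric] diff_divide_distrib add_divide_distrib algebra_simps)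
    finally show ?thesis by (simp add: sum.cartesian_product)
  qed
  have fin: "finite ({..<L} \<times> {..<L})" by simp
  have "(\<Sum>k\<in>?K. of_real ((norm (dirichlet_sum M L k))\<^sup>2) * unit_exp (of_int k * of_int y / real M))
     = (\<Sum>(u, v)\<in>{..<L} \<times> {..<L}. \<Sum>k\<in>?K. unit_exp (of_int k * of_int (y - (int u - int v)) / real M))"
    unfolding * by (subst sum.swap) (simp add: case_prod_unfold)
  also have "\<dots> = (\<Sum>(u, v)\<in>{..<L} \<times> {..<L}. if int M dvd y - (int u - int v) then of_nat M else 0)"
    by (simp only: sum_unit_exp_multiples[OF assms])
  also have "\<dots> = (\<Sum>z\<in>{..<L} \<times> {..<L}. if z \<in> {(u, v). int M dvd y - (int u - int v)} then of_nat M else 0)"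
    by (intro sum.cong refl) (auto simp: case_prod_unfold)
  also have "\<dots> = of_nat (card (({..<L} \<times> {..<L}) \<inter> {(u, v). int M dvd y - (int u - int v)})) * of_nat M"
    by (simp add: sum.If_cases[OF fin])
  also have "({..<L} \<times> {..<L}) \<inter> {(u, v). int M dvd y - (int u - int v)}
      = {(u, v). u < L \<and> v < L \<and> int M dvd y - (int u - int v)}" by auto
  finally show ?thesis by (simp add: bump_def mult.commute)
qed

text \<open>The numbers \<open>\<psi> k\<close> are the Fourier coefficients on \<open>\<int> / 2H\<close>, normalised to mean 1, of a sum of
  triangular bumps around the fractions in \<open>farey_pairs n\<close>; the bumps are disjoint since these fractions are
  \<open>1 / n\<^sup>2\<close>-separated.\<close>

lemma minor_arc_multiplier:
  fixes C \<epsilon> :: real and n :: nat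
  assumes \<epsilon>: "0 < \<epsilon>" "\<epsilon> \<le> 2"
    and C: "\<And>k. k > 0 \<Longrightarrow> real (num_divisors k) \<le> C * real k powr \<epsilon>"
    and n: "n \<ge> 8"
  obtains H :: nat and \<psi> :: "int \<Rightarrow> complex" where
    "n\<^sup>2 \<le> H" "\<psi> 0 = 1"
    "\<And>k. k \<in> {- int H..<int H} \<Longrightarrow> k \<noteq> 0 \<Longrightarrow> norm (\<psi> k) \<le> 32 * C * (2 * (real n)\<^sup>2) powr \<epsilon> / real n"
    "\<And>j. norm (\<Sum>k\<in>{- int H..<int H}. \<psi> k * unit_exp (of_int k * of_int j / real (2 * H))) \<le> 64"
    "\<And>j. (\<Sum>k\<in>{- int H..<int H}. \<psi> k * unit_exp (of_int k * of_int j / real (2 * H))) \<noteq> 0 \<Longrightarrow>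
       \<exists>q a l. n < 4 * q \<and> q \<le> n \<and> coprime a q \<and> \<bar>of_int j / real (2 * H) - real a / real q - of_int l\<bar> < 1 / (2 * (real n)\<^sup>2)"
proof -
  \<comment> \<open>Every \<open>q <= n\<close> divides \<open>n!\<close>, so all the fractions
    \<open>a / q\<close> lie on the grid of step \<open>1 / M\<close>. The factor \<open>n^2\<close>
    in \<open>H\<close> makes the half-width of a bump \<open>L / M = 1 / (2 n^2)\<close>.\<close>
  define L where "L = (fact n :: nat)"
  define H where "H = n\<^sup>2 * L"
  define M where "M = 2 * H"
  define F where "F = farey_pairs n"
  define \<Phi> where "\<Phi> j = (\<Sum>(q, a)\<in>F. bump M L (j - int (a * (M div q))))" for j
  \<comment> \<open>The numerator of \<open>\<psi>\<close> at \<open>k = 0\<close>: there the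
    Dirichlet sum is \<open>L\<close> and each fraction contributes 1.\<close>
  define c where "c = (real L)\<^sup>2 * real (card F)"
  define \<psi> where "\<psi> k = of_real ((norm (dirichlet_sum M L k))\<^sup>2) * (\<Sum>(q, a)\<in>F. unit_exp (of_int (- k) * real a / real q)) / of_real c" for k
  have L: "L > 0" by (simp add: L_def)
  have pos: "n > 0" "H > 0" "M > 0" using n L by (auto simp: H_def M_def)
  have M_eq: "real M = 2 * (real n)\<^sup>2 * real L" by (simp add: M_def H_def)
  have "L \<le> M" using n by (simp add: M_def H_def)
  have cF: "(real n)\<^sup>2 \<le> 32 * real (card F)" unfolding F_def by (rule card_farey_pairs_ge[OF n])
  then have F: "real (card F) > 0" using pos(1)
    by (metis less_le_trans of_nat_0_less_iff zero_less_mult_pos zero_less_numeral zero_less_power)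
  have c: "c > 0" using L F by (simp add: c_def)
  have Fq: "0 < q" "q \<le> n" "n < 4 * q" "coprime a q" "q dvd M" if "(q, a) \<in> F" for q a
  proof -
    show *: "0 < q" "q \<le> n" "n < 4 * q" "coprime a q" using that by (auto simp: F_def farey_pairs_def)
    have "q dvd L" unfolding L_def using * by (intro dvd_fact) auto
    then show "q dvd M" by (simp add: M_def H_def)
  qed
  have frac: "real (a * (M div q)) / real M = real a / real q" if "(q, a) \<in> F" for q a
    using Fq[OF that] pos by (simp add: real_of_nat_div)
  have near: "\<exists>l. \<bar>of_int j / real M - real a / real q - of_int l\<bar> < 1 / (2 * (real n)\<^sup>2)"
    if qa: "(q, a) \<in> F" and b: "bump M L (j - int (a * (M div q))) > 0" for j q a
  proof -
    obtain l where l: "\<bar>j - int (a * (M div q)) - l * int M\<bar> < int L" using bump_pos_imp[OF b] .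
    have "of_int j / real M - real a / real q - of_int l = of_int (j - int (a * (M div q)) - l * int M) / real M"
      using frac[OF qa] pos by (simp add: diff_divide_distrib)
    moreover have "\<bar>real_of_int (j - int (a * (M div q)) - l * int M)\<bar> < real L" using l by linarith
    moreover have "real L / real M = 1 / (2 * (real n)\<^sup>2)" using L by (simp add: M_eq)
    ultimately have "\<bar>of_int j / real M - real a / real q - of_int l\<bar> < 1 / (2 * (real n)\<^sup>2)"
      using pos by (metis abs_divide abs_of_nat divide_strict_right_mono of_nat_0_less_iff)
    then show ?thesis by blast
  qed
  have \<Phi>_le: "\<Phi> j \<le> L" for j
  proof (cases "\<exists>z\<in>F. (case z of (q, a) \<Rightarrow> bump M L (j - int (a * (M div q)))) > 0")
    case True
    then obtain q a where qa: "(q, a) \<in> F" "bump M L (j - int (a * (M div q))) > 0" by auto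
    have zero: "bump M L (j - int (a' * (M div q'))) = 0" if qa': "(q', a') \<in> F" "(q', a') \<noteq> (q, a)" for q' a'
    proof (rule ccontr)
      assume "bump M L (j - int (a' * (M div q'))) \<noteq> 0"
      then obtain l' where l': "\<bar>of_int j / real M - real a' / real q' - of_int l'\<bar> < 1 / (2 * (real n)\<^sup>2)"
        using near[OF qa'(1)] by blast
      obtain l where l: "\<bar>of_int j / real M - real a / real q - of_int l\<bar> < 1 / (2 * (real n)\<^sup>2)"
        using near[OF qa] by blast
      have "\<bar>real a / real q - real a' / real q' - of_int (l' - l)\<bar> < 2 * (1 / (2 * (real n)\<^sup>2))"
        using l l' unfolding of_int_diff by linarith
      moreover have "\<bar>real a / real q - real a' / real q' - of_int (l' - l)\<bar> \<ge> 1 / (real n)\<^sup>2"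
        using qa qa' unfolding F_def by (intro farey_pairs_separated) auto
      ultimately show False by simp
    qed
    have "\<Phi> j = (\<Sum>(q, a)\<in>{(q, a)}. bump M L (j - int (a * (M div q))))"
      unfolding \<Phi>_def
    proof (rule sum.mono_neutral_right)
      show "finite F" unfolding F_def by (rule finite_farey_pairs)
      show "\<forall>z\<in>F - {(q, a)}. (case z of (q, a) \<Rightarrow> bump M L (j - int (a * (M div q)))) = 0"
      proof
        fix z assume "z \<in> F - {(q, a)}"
        then show "(case z of (q, a) \<Rightarrow> bump M L (j - int (a * (M div q)))) = 0"
          by (cases z) (use zero in auto)
      qed
    qed (use qa in simp)
    then show ?thesis using bump_le[OF \<open>L \<le> M\<close>] by simp
  next
    case False
    then have "\<Phi> j = 0" unfolding \<Phi>_def by (intro sum.neutral) auto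
    then show ?thesis by simp
  qed
  have fourier: "(\<Sum>k\<in>{- int H..<int H}. \<psi> k * unit_exp (of_int k * of_int j / real M)) = of_real (real M * real (\<Phi> j) / c)" for j
  proof -
    let ?K = "{- int H..<- int H + int M}"
    let ?d = "\<lambda>k. of_real ((norm (dirichlet_sum M L k))\<^sup>2) :: complex"
    have K: "{- int H..<int H} = ?K" by (simp add: M_def)
    have "of_real (real M * real (\<Phi> j)) = (\<Sum>(q, a)\<in>F. of_nat (M * bump M L (j - int (a * (M div q)))) :: complex)"
      by (simp add: \<Phi>_def sum_distrib_left case_prod_unfold)
    also have "\<dots> = (\<Sum>(q, a)\<in>F. \<Sum>k\<in>?K. ?d k * unit_exp (of_int k * of_int (j - int (a * (M div q))) / real M))"
      by (simp only: bump_fourier[OF pos(3), of L _ "- int H"])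
    also have "\<dots> = (\<Sum>(q, a)\<in>F. \<Sum>k\<in>?K. ?d k * unit_exp (of_int (- k) * real a / real q) * unit_exp (of_int k * of_int j / real M))"
    proof (intro sum.cong refl, clarify, intro sum.cong refl)
      fix q a k assume "(q, a) \<in> F"
      have "of_int k * of_int (j - int (a * (M div q))) / real M
          = of_int k * of_int j / real M - of_int k * (real (a * (M div q)) / real M)"
        by (simp add: right_diff_distrib diff_divide_distrib)
      also have "\<dots> = of_int (- k) * real a / real q + of_int k * of_int j / real M"
        unfolding frac[OF \<open>(q, a) \<in> F\<close>] by simp
      finally show "?d k * unit_exp (of_int k * of_int (j - int (a * (M div q))) / real M)
          = ?d k * unit_exp (of_int (- k) * real a / real q) * unit_exp (of_int k * of_int j / real M)"
        by (simp only: unit_exp_add mult.assoc)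
    qed
    also have "\<dots> = (\<Sum>k\<in>?K. ?d k * (\<Sum>(q, a)\<in>F. unit_exp (of_int (- k) * real a / real q)) * unit_exp (of_int k * of_int j / real M))"
      unfolding case_prod_unfold by (subst sum.swap) (simp only: sum_distrib_left sum_distrib_right)
    also have "\<dots> = of_real c * (\<Sum>k\<in>?K. \<psi> k * unit_exp (of_int k * of_int j / real M))"
      using c by (simp add: \<psi>_def sum_distrib_left)
    finally show ?thesis using c unfolding K by (simp add: field_simps)
  qed
  show ?thesis
  proof (rule that[of H \<psi>])
    show "n\<^sup>2 \<le> H" using L by (simp add: H_def)
    show "\<psi> 0 = 1"
      using c F L by (simp add: \<psi>_def c_def dirichlet_sum_def case_prod_unfold)
  next
    fix k assume k: "k \<in> {- int H..<int H}" "k \<noteq> 0"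
    define X where "X = 2 * (real n)\<^sup>2"
    define y where "y = \<bar>real_of_int k\<bar>"
    have y: "y \<ge> 1" using k unfolding y_def by linarith
    have X: "X > 0" using pos by (simp add: X_def)
    define s where "s = (norm (dirichlet_sum M L k) / real L)\<^sup>2"
    have s: "0 \<le> s" "s \<le> 1" "s \<le> (X / y)\<^sup>2"
    proof -
      have "norm (dirichlet_sum M L k) / real L \<le> 1"
        using norm_dirichlet_sum_le[of M L k] L by simp
      then show "s \<le> 1" unfolding s_def by (intro power_le_one) auto
      have "norm (dirichlet_sum M L k) * y \<le> real M"
        unfolding y_def using k pos by (intro norm_dirichlet_sum_mult_le) (auto simp: M_def)
      then have "norm (dirichlet_sum M L k) / real L \<le> X / y"
        using y L by (simp add: field_simps M_eq X_def)
      then show "s \<le> (X / y)\<^sup>2" unfolding s_def by (intro power_mono) auto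
    qed (simp add: s_def)
    \<comment> \<open>For \<open>y > X\<close> the decay \<open>(X / y)^2\<close> outweighs
      \<open>y powr \<epsilon>\<close>, because \<open>\<epsilon> <= 2\<close>. This makes the bound
      on \<open>\<psi>\<close> uniform, although \<open>|k|\<close> may be far larger than
      \<open>X\<close>.\<close>
    have sy: "s * y powr \<epsilon> \<le> X powr \<epsilon>"
    proof (cases "y \<le> X")
      case True
      have "s * y powr \<epsilon> \<le> 1 * X powr \<epsilon>" using True s y \<epsilon> by (intro mult_mono powr_mono2) auto
      then show ?thesis by simp
    next
      case False
      have "(X / y) powr 2 \<le> (X / y) powr \<epsilon>"
        using False X y \<epsilon> by (intro powr_mono') auto
      then have "(X / y)\<^sup>2 \<le> (X / y) powr \<epsilon>" using X y by simp
      then have "s * y powr \<epsilon> \<le> (X / y) powr \<epsilon> * y powr \<epsilon>" using s by (intro mult_right_mono) auto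
      also have "\<dots> = X powr \<epsilon>" using X y by (simp flip: powr_mult)
      finally show ?thesis .
    qed
    have ny: "real (nat \<bar>- k\<bar>) = y" by (simp add: y_def)
    have "norm (\<psi> k) = (norm (dirichlet_sum M L k))\<^sup>2 * norm (\<Sum>(q, a)\<in>F. unit_exp (of_int (- k) * real a / real q)) / c"
      using c by (simp only: \<psi>_def norm_mult norm_divide norm_of_real abs_power2 abs_of_pos)
    also have "\<dots> = s / real (card F) * norm (\<Sum>(q, a)\<in>F. unit_exp (of_int (- k) * real a / real q))"
      by (simp add: c_def s_def power_divide)
    also have "\<dots> \<le> s / real (card F) * (real n * real (num_divisors (nat \<bar>- k\<bar>)))"
      unfolding F_def using k s by (intro mult_left_mono norm_sum_farey_pairs_le) auto
    also have "\<dots> \<le> s / real (card F) * (real n * (C * y powr \<epsilon>))"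
      using C[of "nat \<bar>- k\<bar>"] k s unfolding ny by (intro mult_left_mono) auto
    also have "\<dots> = C * (s * y powr \<epsilon>) * (real n / real (card F))" by simp
    also have "\<dots> \<le> C * X powr \<epsilon> * (32 / real n)"
    proof (intro mult_mono sy mult_left_mono)
      have "0 \<le> real (num_divisors 1)" by simp
      then show C0: "0 \<le> C" using C[of 1] by simp
      show "real n / real (card F) \<le> 32 / real n"
        using cF F pos by (simp add: field_simps power2_eq_square)
      show "0 \<le> C * X powr \<epsilon>" using C0 by simp
    qed (use s in auto)
    finally show "norm (\<psi> k) \<le> 32 * C * (2 * (real n)\<^sup>2) powr \<epsilon> / real n" by (simp add: X_def mult_ac)
  next
    fix j
    have "real M * real (\<Phi> j) / c \<le> real M * real L / c"
      using c \<Phi>_le[of j] by (intro divide_right_mono mult_left_mono) auto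
    also have "\<dots> = 2 * (real n)\<^sup>2 / real (card F)"
      using L by (simp add: M_eq c_def power2_eq_square)
    also have "\<dots> \<le> 64" using cF F by (simp add: field_simps)
    finally have "real M * real (\<Phi> j) / c \<le> 64" .
    then show "norm (\<Sum>k\<in>{- int H..<int H}. \<psi> k * unit_exp (of_int k * of_int j / real (2 * H))) \<le> 64"
      using c unfolding M_def[symmetric] fourier norm_of_real by simp
  next
    fix j assume "(\<Sum>k\<in>{- int H..<int H}. \<psi> k * unit_exp (of_int k * of_int j / real (2 * H))) \<noteq> 0"
    then have "\<Phi> j \<noteq> 0" unfolding M_def[symmetric] fourier by auto
    then obtain z where z: "z \<in> F" "(case z of (q, a) \<Rightarrow> bump M L (j - int (a * (M div q)))) \<noteq> 0"
      unfolding \<Phi>_def by (rule sum.not_neutral_contains_not_neutral)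
    then obtain q a where qa: "(q, a) \<in> F" "bump M L (j - int (a * (M div q))) > 0" by (cases z) auto
    with near[OF qa] Fq[OF qa(1)]
    show "\<exists>q a l. n < 4 * q \<and> q \<le> n \<and> coprime a q \<and> \<bar>of_int j / real (2 * H) - real a / real q - of_int l\<bar> < 1 / (2 * (real n)\<^sup>2)"
      unfolding M_def by blast
  qed
qed

section \<open>The estimate on a finite lattice\<close>

lemma sum_swap_pairs:
  "(\<Sum>a\<in>A. \<Sum>b\<in>B. \<Sum>c\<in>C. \<Sum>d\<in>D. h a b c d) = (\<Sum>c\<in>C. \<Sum>d\<in>D. \<Sum>a\<in>A. \<Sum>b\<in>B. h a b c d)"
proof -
  have "(\<Sum>a\<in>A. \<Sum>b\<in>B. \<Sum>c\<in>C. \<Sum>d\<in>D. h a b c d) = (\<Sum>a\<in>A. \<Sum>c\<in>C. \<Sum>b\<in>B. \<Sum>d\<in>D. h a b c d)"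
    by (rule sum.cong[OF refl sum.swap])
  also have "\<dots> = (\<Sum>c\<in>C. \<Sum>a\<in>A. \<Sum>b\<in>B. \<Sum>d\<in>D. h a b c d)" by (rule sum.swap)
  also have "\<dots> = (\<Sum>c\<in>C. \<Sum>a\<in>A. \<Sum>d\<in>D. \<Sum>b\<in>B. h a b c d)"
    by (rule sum.cong[OF refl sum.cong[OF refl sum.swap]])
  also have "\<dots> = (\<Sum>c\<in>C. \<Sum>d\<in>D. \<Sum>a\<in>A. \<Sum>b\<in>B. h a b c d)"
    by (rule sum.cong[OF refl sum.swap])
  finally show ?thesis .
qed

section \<open>Boxes, characters and Bessel's inequality on the lattice\<close>

lemma bij_betw_vec_box:
  "bij_betw vec_lambda (PiE (UNIV :: 'd::finite set) A) {\<nu>. \<forall>i. \<nu> $ i \<in> A i}"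
  by (rule bij_betwI[where g = vec_nth]) (auto simp: PiE_def)

lemma sum_vec_box_prod:
  fixes \<phi> :: "'d::finite \<Rightarrow> 'a \<Rightarrow> 'b::comm_semiring_1"
  assumes "\<And>i. finite (A i)"
  shows "(\<Sum>\<nu> | \<forall>i. \<nu> $ i \<in> A i. \<Prod>i\<in>UNIV. \<phi> i (\<nu> $ i)) = (\<Prod>i\<in>UNIV. \<Sum>m\<in>A i. \<phi> i m)"
proof -
  have "(\<Prod>i\<in>UNIV. \<Sum>m\<in>A i. \<phi> i m) = (\<Sum>g\<in>PiE UNIV A. \<Prod>i\<in>UNIV. \<phi> i (g i))"
    by (rule prod_sum_PiE) (use assms in auto)
  also have "\<dots> = (\<Sum>\<nu> | \<forall>i. \<nu> $ i \<in> A i. \<Prod>i\<in>UNIV. \<phi> i (\<nu> $ i))"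
    by (subst sum.reindex_bij_betw[OF bij_betw_vec_box, symmetric]) simp
  finally show ?thesis ..
qed

lemma finite_vec_box: "(\<And>i. finite (A i)) \<Longrightarrow> finite {\<nu> :: 'a ^ 'd::finite. \<forall>i. \<nu> $ i \<in> A i}"
  using bij_betw_finite[OF bij_betw_vec_box[of A]] by (simp add: finite_PiE)

definition int_dot :: "int ^ 'd::finite \<Rightarrow> int ^ 'd \<Rightarrow> int" where
  "int_dot \<nu> g = (\<Sum>i\<in>UNIV. \<nu> $ i * g $ i)"

lemma int_dot_diff: "int_dot \<nu> (g - g') = int_dot \<nu> g - int_dot \<nu> g'"
  by (simp add: int_dot_def right_diff_distrib sum_subtractf)

definition lattice_box :: "nat \<Rightarrow> ((int ^ 'd::finite) \<times> int) set" where
  "lattice_box M = {(g, j). (\<forall>i. g $ i \<in> {0..<int M}) \<and> j \<in> {0..<int M}}"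

lemma finite_lattice_box: "finite (lattice_box M :: ((int ^ 'd::finite) \<times> int) set)"
proof -
  have "lattice_box M = {g :: int ^ 'd. \<forall>i. g $ i \<in> {0..<int M}} \<times> {0..<int M}"
    by (auto simp: lattice_box_def)
  then show ?thesis by (simp only: finite_cartesian_product finite_vec_box finite_atLeastLessThan_int)
qed

definition lattice_char :: "nat \<Rightarrow> int ^ 'd::finite \<Rightarrow> int \<Rightarrow> (int ^ 'd) \<times> int \<Rightarrow> complex" where
  "lattice_char M \<nu> k z = unit_exp (of_int (int_dot \<nu> (fst z) + k * snd z) / real M)"

lemma lattice_char_mult_cnj:
  "lattice_char M \<nu> k z * cnj (lattice_char M \<nu> k z') = lattice_char M \<nu> k (z - z')"
  by (simp add: lattice_char_def cnj_unit_exp unit_exp_add[symmetric] int_dot_diff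
        diff_divide_distrib add_divide_distrib algebra_simps)

lemma lattice_char_split:
  "lattice_char M \<nu> k z = (\<Prod>i\<in>UNIV. unit_exp (of_int (\<nu> $ i) * of_int (fst z $ i) / real M)) * unit_exp (of_int k * of_int (snd z) / real M)"
  by (simp add: lattice_char_def int_dot_def add_divide_distrib unit_exp_add unit_exp_sum sum_divide_distrib)

definition lattice_transform ::
  "nat \<Rightarrow> ((int ^ 'd::finite) \<times> int) set \<Rightarrow> ((int ^ 'd) \<times> int \<Rightarrow> complex) \<Rightarrow> int ^ 'd \<Rightarrow> int \<Rightarrow> complex" where
  "lattice_transform M P f \<nu> k = (\<Sum>z\<in>P. f z * lattice_char M \<nu> k z)"

lemma norm_lattice_transform_squared:
  "of_real ((norm (lattice_transform M P f \<nu> k))\<^sup>2)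
     = (\<Sum>z\<in>P. \<Sum>z'\<in>P. f z * cnj (f z') * lattice_char M \<nu> k (z - z'))"
proof -
  have "of_real ((norm (lattice_transform M P f \<nu> k))\<^sup>2) = lattice_transform M P f \<nu> k * cnj (lattice_transform M P f \<nu> k)"
    by (rule complex_norm_square)
  also have "\<dots> = (\<Sum>z\<in>P. \<Sum>z'\<in>P. f z * lattice_char M \<nu> k z * (cnj (f z') * cnj (lattice_char M \<nu> k z')))"
    by (simp add: lattice_transform_def sum_product)
  also have "\<dots> = (\<Sum>z\<in>P. \<Sum>z'\<in>P. f z * cnj (f z') * lattice_char M \<nu> k (z - z'))"
    by (intro sum.cong refl) (simp add: lattice_char_mult_cnj[symmetric] mult_ac)
  finally show ?thesis .
qed

text \<open>For each \<open>\<nu>\<close> the shifted frequencies \<open>s \<nu> + k\<close> still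
  run once through all residues modulo \<open>2 H\<close>, so the characters are orthogonal and
  Parseval holds on the full box of \<open>\<nu>\<close>. The shift will be
  \<open>sq_length\<close>, which puts the frequencies on translates of the paraboloid.\<close>

lemma lattice_bessel:
  fixes f :: "(int ^ 'd::finite) \<times> int \<Rightarrow> complex" and s :: "int ^ 'd \<Rightarrow> int"
  assumes "H > 0" and P: "P \<subseteq> lattice_box (2 * H)"
    and V: "V \<subseteq> {\<nu>. \<forall>i. \<nu> $ i \<in> {- int H..<int H}}"
  shows "(\<Sum>\<nu>\<in>V. \<Sum>k\<in>{- int H..<int H}. (norm (lattice_transform (2 * H) P f \<nu> (s \<nu> + k)))\<^sup>2)
     \<le> real (2 * H) ^ (CARD('d) + 1) * (\<Sum>z\<in>P. (norm (f z))\<^sup>2)"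
proof -
  define M where "M = 2 * H"
  have M: "M > 0" using assms by (simp add: M_def)
  define K where "K = {- int H..<int H}"
  have K: "K = {- int H..<- int H + int M}" by (simp add: K_def M_def)
  define B where "B = {\<nu> :: int ^ 'd. \<forall>i. \<nu> $ i \<in> K}"
  have finB: "finite B" unfolding B_def K_def by (intro finite_vec_box) simp
  have finP: "finite P" using P finite_lattice_box by (rule finite_subset)
  have orth: "(\<Sum>\<nu>\<in>B. \<Sum>k\<in>K. lattice_char M \<nu> (s \<nu> + k) (z - z')) = (if z = z' then of_nat M ^ (CARD('d) + 1) else 0)"
    if z: "z \<in> P" "z' \<in> P" for z z'
  proof -
    obtain g j g' j' where zz: "z = (g, j)" "z' = (g', j')" by fastforce
    have sp: "lattice_char M \<nu> (s \<nu> + k) (z - z')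
        = (\<Prod>i\<in>UNIV. unit_exp (of_int (\<nu> $ i) * of_int ((g - g') $ i) / real M)) * unit_exp (of_int (s \<nu>) * of_int (j - j') / real M)
          * unit_exp (of_int k * of_int (j - j') / real M)" for \<nu> k
      unfolding lattice_char_split zz
      by (simp add: distrib_right add_divide_distrib unit_exp_add)
    have close: "int M dvd x - y \<longleftrightarrow> x = y" if "x \<in> {0..<int M}" "y \<in> {0..<int M}" for x y
      using that zdvd_imp_le[of "int M" "\<bar>x - y\<bar>"] by (cases "x = y") auto
    have mem: "j \<in> {0..<int M}" "j' \<in> {0..<int M}" "g $ i \<in> {0..<int M}" "g' $ i \<in> {0..<int M}" for i
      using P z zz by (auto simp: lattice_box_def M_def)
    have inner: "(\<Sum>k\<in>K. unit_exp (of_int k * of_int (j - j') / real M)) = (if j = j' then of_nat M else 0)"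
      unfolding K sum_unit_exp_multiples[OF M] using close mem by simp
    have "(\<Sum>\<nu>\<in>B. \<Sum>k\<in>K. lattice_char M \<nu> (s \<nu> + k) (z - z'))
       = (\<Sum>\<nu>\<in>B. (\<Prod>i\<in>UNIV. unit_exp (of_int (\<nu> $ i) * of_int ((g - g') $ i) / real M)) * unit_exp (of_int (s \<nu>) * of_int (j - j') / real M)
          * (if j = j' then of_nat M else 0))"
      unfolding sp by (simp only: sum_distrib_left[symmetric] inner)
    also have "\<dots> = (if j = j' then of_nat M else 0) *
       (\<Sum>\<nu>\<in>B. \<Prod>i\<in>UNIV. unit_exp (of_int (\<nu> $ i) * of_int ((g - g') $ i) / real M))"
      by (simp add: sum_distrib_left mult.commute)
    also have "(\<Sum>\<nu>\<in>B. \<Prod>i\<in>UNIV. unit_exp (of_int (\<nu> $ i) * of_int ((g - g') $ i) / real M))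
       = (\<Prod>i\<in>UNIV. \<Sum>m\<in>K. unit_exp (of_int m * of_int ((g - g') $ i) / real M))"
      unfolding B_def by (rule sum_vec_box_prod) (simp add: K_def)
    also have "\<dots> = (\<Prod>i\<in>UNIV. if g $ i = g' $ i then of_nat M else 0)"
      unfolding K sum_unit_exp_multiples[OF M] using close mem by simp
    also have "\<dots> = (if g = g' then of_nat M ^ CARD('d) else 0)"
    proof (cases "g = g'")
      case False
      then obtain i where "g $ i \<noteq> g' $ i" by (auto simp: vec_eq_iff)
      then have "(\<Prod>i\<in>UNIV. if g $ i = g' $ i then of_nat M else 0 :: complex) = 0"
        by (intro prod_zero) auto
      then show ?thesis using False by simp
    qed simp
    finally show ?thesis unfolding zz by simp
  qed
  have "(\<Sum>\<nu>\<in>V. \<Sum>k\<in>K. (norm (lattice_transform M P f \<nu> (s \<nu> + k)))\<^sup>2)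
      \<le> (\<Sum>\<nu>\<in>B. \<Sum>k\<in>K. (norm (lattice_transform M P f \<nu> (s \<nu> + k)))\<^sup>2)"
    using V finB by (intro sum_mono2) (auto simp: B_def K_def intro: sum_nonneg)
  also have "\<dots> = real M ^ (CARD('d) + 1) * (\<Sum>z\<in>P. (norm (f z))\<^sup>2)"
  proof -
    have "complex_of_real (\<Sum>\<nu>\<in>B. \<Sum>k\<in>K. (norm (lattice_transform M P f \<nu> (s \<nu> + k)))\<^sup>2)
       = (\<Sum>\<nu>\<in>B. \<Sum>k\<in>K. \<Sum>z\<in>P. \<Sum>z'\<in>P. f z * cnj (f z') * lattice_char M \<nu> (s \<nu> + k) (z - z'))"
      by (simp only: of_real_sum norm_lattice_transform_squared)
    also have "\<dots> = (\<Sum>z\<in>P. \<Sum>z'\<in>P. \<Sum>\<nu>\<in>B. \<Sum>k\<in>K. f z * cnj (f z') * lattice_char M \<nu> (s \<nu> + k) (z - z'))"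
      by (rule sum_swap_pairs)
    also have "\<dots> = (\<Sum>z\<in>P. \<Sum>z'\<in>P. f z * cnj (f z') * (if z = z' then of_nat M ^ (CARD('d) + 1) else 0))"
      by (intro sum.cong refl) (simp only: sum_distrib_left[symmetric] orth)
    also have "\<dots> = (\<Sum>z\<in>P. f z * cnj (f z) * of_nat M ^ (CARD('d) + 1))"
      by (intro sum.cong refl) (simp add: if_distrib[of "\<lambda>x. _ * x"] sum.delta'[OF finP] cong: if_cong)
    also have "\<dots> = complex_of_real (real M ^ (CARD('d) + 1) * (\<Sum>z\<in>P. (norm (f z))\<^sup>2))"
      by (simp add: complex_norm_square[unfolded of_real_power] sum_distrib_left mult_ac)
    finally show ?thesis unfolding of_real_eq_iff .
  qed
  finally show ?thesis unfolding M_def K_def .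
qed

section \<open>The weighted kernel and the level set on the lattice\<close>

definition sq_length :: "int ^ 'd::finite \<Rightarrow> int" where
  "sq_length \<nu> = (\<Sum>i\<in>UNIV. (\<nu> $ i)\<^sup>2)"

definition tent_weight :: "nat \<Rightarrow> int ^ 'd::finite \<Rightarrow> real" where
  "tent_weight N \<nu> = (\<Prod>i\<in>UNIV. tent N (\<nu> $ i))"

lemma tent_weight_nonneg: "tent_weight N \<nu> \<ge> 0"
  by (simp add: tent_weight_def prod_nonneg tent_nonneg)

lemma tent_weight_le: "tent_weight N (\<nu> :: int ^ 'd::finite) \<le> 2 ^ CARD('d)"
proof -
  have "tent_weight N \<nu> \<le> (\<Prod>i\<in>(UNIV :: 'd set). 2)"
    unfolding tent_weight_def by (intro prod_mono) (simp add: tent_nonneg tent_le_2)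
  then show ?thesis by simp
qed

lemma tent_weight_ge_1: "N > 0 \<Longrightarrow> \<nu> \<in> freq_box N \<Longrightarrow> tent_weight N \<nu> \<ge> 1"
  unfolding tent_weight_def freq_box_def by (intro prod_ge_1) (auto intro: tent_ge_1)

text \<open>The weight is a product over the coordinates and \<open>sq_length\<close> a sum, so the
  kernel factors into one-dimensional Weyl sums that share the same time variable.\<close>

lemma sum_tent_weight_lattice_char:
  fixes z :: "(int ^ 'd::finite) \<times> int"
  shows "(\<Sum>\<nu>\<in>freq_box (2 * N). of_real (tent_weight N \<nu>) * lattice_char M \<nu> (sq_length \<nu>) z)
     = (\<Prod>i\<in>UNIV. weyl_sum N (of_int (fst z $ i) / real M) (of_int (snd z) / real M))"
proof -
  have box: "(freq_box (2 * N) :: (int ^ 'd) set) = {\<nu>. \<forall>i. \<nu> $ i \<in> {- 2 * int N..2 * int N}}"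
    by (auto simp: freq_box_def abs_le_iff minus_le_iff)
  have "of_real (tent_weight N \<nu>) * lattice_char M \<nu> (sq_length \<nu>) z
    = (\<Prod>i\<in>UNIV. of_real (tent N (\<nu> $ i)) * unit_exp (of_int (\<nu> $ i) * (of_int (fst z $ i) / real M) + (of_int (\<nu> $ i))\<^sup>2 * (of_int (snd z) / real M)))"
    for \<nu>
  proof -
    have "unit_exp (of_int (sq_length \<nu>) * of_int (snd z) / real M) = unit_exp (\<Sum>i\<in>UNIV. (of_int (\<nu> $ i))\<^sup>2 * (of_int (snd z) / real M))"
      by (simp add: sq_length_def sum_distrib_right sum_divide_distrib)
    also have "\<dots> = (\<Prod>i\<in>UNIV. unit_exp ((of_int (\<nu> $ i))\<^sup>2 * (of_int (snd z) / real M)))"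
      by (rule unit_exp_sum) simp
    finally show ?thesis
      by (simp add: lattice_char_split tent_weight_def prod.distrib unit_exp_add)
  qed
  then show ?thesis
    unfolding box weyl_sum_def
    by (simp only:) (rule sum_vec_box_prod[where \<phi> = "\<lambda>i m. of_real (tent N m) * unit_exp (of_int m * (of_int (fst z $ i) / real M) + (of_int m)\<^sup>2 * (of_int (snd z) / real M))"], simp)
qed

text \<open>The integer \<open>l\<close> is absorbed by replacing \<open>a\<close> with
  \<open>a + l q\<close>, which stays coprime to \<open>q\<close>; and
  \<open>64 N <= n < 4 q\<close> gives \<open>16 N < q\<close>.\<close>

lemma norm_weyl_sum_near_farey_le:
  fixes q a n N :: nat
  assumes "N > 0" "64 * N \<le> n" "n < 4 * q" "q \<le> n" "coprime a q"
    and "\<bar>t - real a / real q - of_int l\<bar> < 1 / (2 * (real n)\<^sup>2)"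
  shows "norm (weyl_sum N x t) \<le> sqrt (216 * real n)"
proof -
  have q: "q > 0" using assms by auto
  have "(norm (weyl_sum N x t))\<^sup>2 \<le> 216 * real q"
  proof (rule norm_weyl_sum_le[where a = "int a + l * int q"])
    have "gcd (int q) (l * int q + int a) = gcd (int q) (int a)" by (rule gcd_add_mult)
    also have "\<dots> = 1" using assms(5) by (simp add: coprime_commute flip: coprime_iff_gcd_eq_1)
    finally show "coprime (int a + l * int q) (int q)"
      by (simp add: coprime_iff_gcd_eq_1 gcd.commute add.commute)
    have "real a / real q + of_int l = of_int (int a + l * int q) / real q"
      using q by (simp add: field_simps)
    then have "\<bar>t - of_int (int a + l * int q) / real q\<bar> < 1 / (2 * (real n)\<^sup>2)"
      using assms(6) by (simp add: diff_diff_eq)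
    also have "\<dots> \<le> 1 / (real q)\<^sup>2"
    proof (intro divide_left_mono)
      have "(real q)\<^sup>2 \<le> (real n)\<^sup>2" using assms by (intro power_mono) auto
      also have "\<dots> \<le> 2 * (real n)\<^sup>2" by simp
      finally show "(real q)\<^sup>2 \<le> 2 * (real n)\<^sup>2" .
    qed (use q assms in auto)
    finally show "\<bar>t - of_int (int a + l * int q) / real q\<bar> \<le> 1 / (real q)\<^sup>2" by simp
  qed (use assms in auto)
  also have "\<dots> \<le> 216 * real n" using assms by simp
  finally show ?thesis by (rule real_le_rsqrt)
qed

text \<open>\<open>G k\<close> is the weighted energy of \<open>f\<close> on the paraboloid moved by
  \<open>k\<close> in the time frequency. Multiplying the kernel by \<open>\<theta>\<close> turns
  \<open>G 0\<close> into the sum of \<open>\<psi> k * G k\<close>; as \<open>\<psi> 0 = 1\<close>,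
  the error consists of the terms \<open>k \<noteq> 0\<close>, at most \<open>\<delta>\<close> times
  the energy over all translates.\<close>

lemma lattice_level_set_bound:
  fixes a :: "int ^ 'd::finite \<Rightarrow> complex" and P :: "((int ^ 'd) \<times> int) set" and \<psi> :: "int \<Rightarrow> complex"
  assumes N: "N > 0" "64 * N \<le> n" and H: "n\<^sup>2 \<le> H"
    and \<psi>: "\<psi> 0 = 1" "\<And>k. k \<in> {- int H..<int H} \<Longrightarrow> k \<noteq> 0 \<Longrightarrow> norm (\<psi> k) \<le> \<delta>"
    and \<theta>_le: "\<And>j. norm (\<Sum>k\<in>{- int H..<int H}. \<psi> k * unit_exp (of_int k * of_int j / real (2 * H))) \<le> 64"
    and \<theta>_supp: "\<And>j. (\<Sum>k\<in>{- int H..<int H}. \<psi> k * unit_exp (of_int k * of_int j / real (2 * H))) \<noteq> 0 \<Longrightarrow>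
       \<exists>q a l. n < 4 * q \<and> q \<le> n \<and> coprime a q \<and> \<bar>of_int j / real (2 * H) - real a / real q - of_int l\<bar> < 1 / (2 * (real n)\<^sup>2)"
    and "\<delta> \<ge> 0" and a: "(\<Sum>\<nu>\<in>freq_box N. (norm (a \<nu>))\<^sup>2) = 1" and "lam \<ge> 0"
    and P: "P \<subseteq> lattice_box (2 * H)"
    and large: "\<And>z. z \<in> P \<Longrightarrow> lam < norm (\<Sum>\<nu>\<in>freq_box N. a \<nu> * lattice_char (2 * H) \<nu> (sq_length \<nu>) z)"
  shows "lam\<^sup>2 * (real (card P))\<^sup>2 \<le> 64 * sqrt (216 * real n) ^ CARD('d) * (real (card P))\<^sup>2
           + 2 ^ CARD('d) * \<delta> * real (2 * H) ^ (CARD('d) + 1) * real (card P)"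
proof -
  define M where "M = 2 * H"
  define K where "K = {- int H..<int H}"
  define V where "V = (freq_box (2 * N) :: (int ^ 'd) set)"
  define S where "S z = (\<Sum>\<nu>\<in>freq_box N. a \<nu> * lattice_char M \<nu> (sq_length \<nu>) z)" for z
  define f where "f z = cnj (S z) / of_real (norm (S z))" for z
  define T where "T \<nu> k = lattice_transform M P f \<nu> (sq_length \<nu> + k)" for \<nu> k
  define G where "G k = (\<Sum>\<nu>\<in>V. tent_weight N \<nu> * (norm (T \<nu> k))\<^sup>2)" for k
  define \<theta> where "\<theta> j = (\<Sum>k\<in>K. \<psi> k * unit_exp (of_int k * of_int j / real M))" for j
  have finP: "finite P" using P finite_lattice_box by (rule finite_subset)
  have finV: "finite V" unfolding V_def by (rule finite_freq_box)
  \<comment> \<open>The frequencies of the kernel reach \<open>2 N\<close> and must fit into the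
    window \<open>{- H..<H}\<close>, where distinct frequencies give distinct characters.\<close>
  have nH: "2 * N < H" "H > 0"
  proof -
    have "2 * N < n" using N by simp
    also have "n \<le> n\<^sup>2" using N by (simp add: power2_eq_square)
    also note H
    finally show "2 * N < H" .
    then show "H > 0" by simp
  qed
  have f: "norm (f z) = 1" "f z * S z = of_real (norm (S z))" if "z \<in> P" for z
  proof -
    have "norm (S z) > 0" using large[OF that] \<open>lam \<ge> 0\<close> unfolding S_def M_def by (rule order.strict_trans1[rotated])
    then show "norm (f z) = 1" by (simp add: f_def norm_divide)
    have "f z * S z = of_real ((norm (S z))\<^sup>2) / of_real (norm (S z))"
      by (simp only: f_def complex_norm_square) (simp add: mult.commute)
    then show "f z * S z = of_real (norm (S z))"
      using \<open>norm (S z) > 0\<close> by (simp add: power2_eq_square)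
  qed
  \<comment> \<open>Duality: the sum of \<open>|S|\<close> over \<open>P\<close> is the pairing of
    \<open>a\<close> with the transform of \<open>f\<close> on the paraboloid. Cauchy-Schwarz
    removes \<open>a\<close>, and the weight is at least 1 on the box.\<close>
  have lower: "lam\<^sup>2 * (real (card P))\<^sup>2 \<le> G 0"
  proof -
    have "of_real (\<Sum>z\<in>P. norm (S z)) = (\<Sum>z\<in>P. f z * S z)" using f by simp
    also have "\<dots> = (\<Sum>\<nu>\<in>freq_box N. a \<nu> * T \<nu> 0)"
      unfolding S_def T_def lattice_transform_def sum_distrib_left
      by (subst sum.swap) (simp add: mult_ac)
    finally have "norm (\<Sum>\<nu>\<in>freq_box N. a \<nu> * T \<nu> 0) = \<bar>\<Sum>z\<in>P. norm (S z)\<bar>"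
      by (metis norm_of_real)
    then have "(\<Sum>z\<in>P. norm (S z)) \<le> norm (\<Sum>\<nu>\<in>freq_box N. a \<nu> * T \<nu> 0)" by simp
    moreover have "lam * real (card P) \<le> (\<Sum>z\<in>P. norm (S z))"
      using sum_mono[of P "\<lambda>_. lam" "\<lambda>z. norm (S z)"] large by (force simp: S_def M_def mult.commute less_imp_le)
    ultimately have "lam * real (card P) \<le> (\<Sum>\<nu>\<in>freq_box N. norm (a \<nu>) * norm (T \<nu> 0))"
      using norm_sum[of "\<lambda>\<nu>. a \<nu> * T \<nu> 0" "freq_box N"] by (simp add: norm_mult)
    then have "(lam * real (card P))\<^sup>2 \<le> (\<Sum>\<nu>\<in>freq_box N. norm (a \<nu>) * norm (T \<nu> 0))\<^sup>2"
      using \<open>lam \<ge> 0\<close> by (intro power_mono) auto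
    also have "\<dots> \<le> (\<Sum>\<nu>\<in>freq_box N. (norm (a \<nu>))\<^sup>2) * (\<Sum>\<nu>\<in>freq_box N. (norm (T \<nu> 0))\<^sup>2)"
      by (rule Cauchy_Schwarz_ineq_sum)
    also have "\<dots> = (\<Sum>\<nu>\<in>freq_box N. (norm (T \<nu> 0))\<^sup>2)" using a by simp
    also have "\<dots> \<le> (\<Sum>\<nu>\<in>freq_box N. tent_weight N \<nu> * (norm (T \<nu> 0))\<^sup>2)"
    proof (rule sum_mono)
      fix \<nu> :: "int ^ 'd" assume "\<nu> \<in> freq_box N"
      then show "(norm (T \<nu> 0))\<^sup>2 \<le> tent_weight N \<nu> * (norm (T \<nu> 0))\<^sup>2"
        using mult_right_mono[OF tent_weight_ge_1[OF N(1)], of \<nu> "(norm (T \<nu> 0))\<^sup>2"] by simp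
    qed
    also have "\<dots> \<le> G 0" unfolding G_def
    proof (rule sum_mono2[OF finV])
      show "freq_box N \<subseteq> V" unfolding V_def freq_box_def by (auto intro: order.trans)
    qed (simp add: tent_weight_nonneg)
    finally show ?thesis by (simp add: power_mult_distrib)
  qed
  \<comment> \<open>This will be applied to differences of lattice points, whose coordinates may be
    negative; hence the hypotheses on \<open>\<theta>\<close> for all integers \<open>j\<close>,
    with a translation \<open>l\<close>.\<close>
  have kernel: "norm ((\<Sum>\<nu>\<in>V. of_real (tent_weight N \<nu>) * lattice_char M \<nu> (sq_length \<nu>) z) * \<theta> (snd z))
      \<le> 64 * sqrt (216 * real n) ^ CARD('d)" for z :: "(int ^ 'd) \<times> int"
  proof (cases "\<theta> (snd z) = 0")
    case False
    then obtain q b l where qbl: "n < 4 * q" "q \<le> n" "coprime b q"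
        "\<bar>of_int (snd z) / real M - real b / real q - of_int l\<bar> < 1 / (2 * (real n)\<^sup>2)"
      using \<theta>_supp[of "snd z"] unfolding \<theta>_def K_def M_def by blast
    have "norm (\<Sum>\<nu>\<in>V. of_real (tent_weight N \<nu>) * lattice_char M \<nu> (sq_length \<nu>) z)
        = (\<Prod>i\<in>UNIV. norm (weyl_sum N (of_int (fst z $ i) / real M) (of_int (snd z) / real M)))"
      unfolding V_def sum_tent_weight_lattice_char by (rule prod_norm[symmetric])
    also have "\<dots> \<le> (\<Prod>i\<in>(UNIV :: 'd set). sqrt (216 * real n))"
      by (intro prod_mono conjI norm_weyl_sum_near_farey_le[OF N qbl]) simp
    finally have "norm (\<Sum>\<nu>\<in>V. of_real (tent_weight N \<nu>) * lattice_char M \<nu> (sq_length \<nu>) z) \<le> sqrt (216 * real n) ^ CARD('d)"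
      by simp
    then have "norm (\<Sum>\<nu>\<in>V. of_real (tent_weight N \<nu>) * lattice_char M \<nu> (sq_length \<nu>) z) * norm (\<theta> (snd z))
       \<le> sqrt (216 * real n) ^ CARD('d) * 64"
      using \<theta>_le[of "snd z"] by (intro mult_mono) (auto simp: \<theta>_def K_def M_def)
    then show ?thesis by (simp add: norm_mult mult.commute)
  qed simp
  \<comment> \<open>Squaring out every transform gives a double sum over \<open>P\<close> with the
    kernel times \<open>\<theta>\<close> at \<open>z - z'\<close>. As \<open>f\<close> is unimodular
    on \<open>P\<close>, the supremum of the kernel times the number of pairs bounds it.\<close>
  have upper: "norm (\<Sum>k\<in>K. \<psi> k * of_real (G k)) \<le> 64 * sqrt (216 * real n) ^ CARD('d) * (real (card P))\<^sup>2"
  proof -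
    have "(\<Sum>k\<in>K. \<psi> k * of_real (G k))
       = (\<Sum>k\<in>K. \<Sum>\<nu>\<in>V. \<Sum>z\<in>P. \<Sum>z'\<in>P. f z * cnj (f z') * (of_real (tent_weight N \<nu>) * lattice_char M \<nu> (sq_length \<nu>) (z - z'))
            * (\<psi> k * unit_exp (of_int k * of_int (snd (z - z')) / real M)))"
    proof (intro sum.cong refl)
      fix k
      have "lattice_char M \<nu> (sq_length \<nu> + k) z = lattice_char M \<nu> (sq_length \<nu>) z * unit_exp (of_int k * of_int (snd z) / real M)" for \<nu> and z :: "(int ^ 'd) \<times> int"
        by (simp only: lattice_char_split of_int_add distrib_right add_divide_distrib unit_exp_add mult.assoc)
      then show "\<psi> k * of_real (G k)
       = (\<Sum>\<nu>\<in>V. \<Sum>z\<in>P. \<Sum>z'\<in>P. f z * cnj (f z') * (of_real (tent_weight N \<nu>) * lattice_char M \<nu> (sq_length \<nu>) (z - z'))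
            * (\<psi> k * unit_exp (of_int k * of_int (snd (z - z')) / real M)))"
        unfolding G_def of_real_sum of_real_mult T_def norm_lattice_transform_squared sum_distrib_left
        by (intro sum.cong refl) (simp only: mult_ac)
    qed
    also have "\<dots> = (\<Sum>z\<in>P. \<Sum>z'\<in>P. \<Sum>\<nu>\<in>V. \<Sum>k\<in>K. f z * cnj (f z') * (of_real (tent_weight N \<nu>) * lattice_char M \<nu> (sq_length \<nu>) (z - z'))
            * (\<psi> k * unit_exp (of_int k * of_int (snd (z - z')) / real M)))"
      by (subst sum.swap) (rule sum_swap_pairs)
    also have "\<dots> = (\<Sum>z\<in>P. \<Sum>z'\<in>P. f z * cnj (f z') *
         ((\<Sum>\<nu>\<in>V. of_real (tent_weight N \<nu>) * lattice_char M \<nu> (sq_length \<nu>) (z - z')) * \<theta> (snd (z - z'))))"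
      unfolding \<theta>_def by (intro sum.cong refl) (simp only: sum_product mult.assoc, simp only: sum_distrib_left)
    finally have "norm (\<Sum>k\<in>K. \<psi> k * of_real (G k)) \<le> (\<Sum>z\<in>P. \<Sum>z'\<in>P. norm (f z * cnj (f z') *
         ((\<Sum>\<nu>\<in>V. of_real (tent_weight N \<nu>) * lattice_char M \<nu> (sq_length \<nu>) (z - z')) * \<theta> (snd (z - z')))))"
      by (simp only:) (intro order.trans[OF norm_sum] sum_mono order.refl norm_sum)
    also have "\<dots> \<le> (\<Sum>z\<in>P. \<Sum>z'\<in>P. 1 * (64 * sqrt (216 * real n) ^ CARD('d)))"
    proof (intro sum_mono)
      fix z z' assume "z \<in> P" "z' \<in> P"
      then have "norm (f z * cnj (f z')) = 1" using f by (simp add: norm_mult)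
      then show "norm (f z * cnj (f z') * ((\<Sum>\<nu>\<in>V. of_real (tent_weight N \<nu>) * lattice_char M \<nu> (sq_length \<nu>) (z - z')) * \<theta> (snd (z - z'))))
         \<le> 1 * (64 * sqrt (216 * real n) ^ CARD('d))"
        using kernel[of "z - z'"] by (subst norm_mult) simp
    qed
    also have "\<dots> = 64 * sqrt (216 * real n) ^ CARD('d) * (real (card P))\<^sup>2"
      by (simp add: power2_eq_square)
    finally show ?thesis .
  qed
  have G_nonneg: "G k \<ge> 0" for k by (simp add: G_def sum_nonneg tent_weight_nonneg)
  have sum_G: "(\<Sum>k\<in>K. G k) \<le> 2 ^ CARD('d) * (real M ^ (CARD('d) + 1) * real (card P))"
  proof -
    have "(\<Sum>k\<in>K. G k) = (\<Sum>\<nu>\<in>V. tent_weight N \<nu> * (\<Sum>k\<in>K. (norm (T \<nu> k))\<^sup>2))"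
      unfolding G_def sum_distrib_left by (rule sum.swap)
    also have "\<dots> \<le> (\<Sum>\<nu>\<in>V. 2 ^ CARD('d) * (\<Sum>k\<in>K. (norm (T \<nu> k))\<^sup>2))"
      by (intro sum_mono mult_right_mono tent_weight_le sum_nonneg) simp
    also have "\<dots> = 2 ^ CARD('d) * (\<Sum>\<nu>\<in>V. \<Sum>k\<in>K. (norm (T \<nu> k))\<^sup>2)"
      by (simp only: sum_distrib_left)
    also have "(\<Sum>\<nu>\<in>V. \<Sum>k\<in>K. (norm (T \<nu> k))\<^sup>2) \<le> real M ^ (CARD('d) + 1) * (\<Sum>z\<in>P. (norm (f z))\<^sup>2)"
      unfolding T_def M_def K_def
    proof (rule lattice_bessel[OF nH(2) P])
      show "V \<subseteq> {\<nu>. \<forall>i. \<nu> $ i \<in> {- int H..<int H}}"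
      proof (intro subsetI CollectI allI)
        fix \<nu> :: "int ^ 'd" and i assume "\<nu> \<in> V"
        then have "\<bar>\<nu> $ i\<bar> \<le> int (2 * N)" unfolding V_def freq_box_def by blast
        then show "\<nu> $ i \<in> {- int H..<int H}" using nH by auto
      qed
    qed
    also have "(\<Sum>z\<in>P. (norm (f z))\<^sup>2) = real (card P)" using f by simp
    finally show ?thesis by simp
  qed
  have "0 \<in> K" "finite K" using nH by (auto simp: K_def)
  have "(\<Sum>k\<in>K. \<psi> k * of_real (G k)) = of_real (G 0) + (\<Sum>k\<in>K - {0}. \<psi> k * of_real (G k))"
    using \<psi>(1) by (simp add: sum.remove[OF \<open>finite K\<close> \<open>0 \<in> K\<close>])
  then have "norm (complex_of_real (G 0)) = norm ((\<Sum>k\<in>K. \<psi> k * of_real (G k)) - (\<Sum>k\<in>K - {0}. \<psi> k * of_real (G k)))"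
    by simp
  also have "\<dots> \<le> norm (\<Sum>k\<in>K. \<psi> k * of_real (G k)) + norm (\<Sum>k\<in>K - {0}. \<psi> k * of_real (G k))"
    by (rule norm_triangle_ineq4)
  also have "norm (\<Sum>k\<in>K - {0}. \<psi> k * of_real (G k)) \<le> (\<Sum>k\<in>K - {0}. \<delta> * G k)"
  proof (rule order.trans[OF norm_sum sum_mono])
    fix k assume "k \<in> K - {0}"
    then show "norm (\<psi> k * of_real (G k)) \<le> \<delta> * G k"
      using \<psi>(2)[of k] G_nonneg[of k] by (simp add: norm_mult K_def mult_right_mono)
  qed
  also have "(\<Sum>k\<in>K - {0}. \<delta> * G k) \<le> (\<Sum>k\<in>K. \<delta> * G k)"
    using \<open>finite K\<close> \<open>\<delta> \<ge> 0\<close> G_nonneg by (intro sum_mono2) auto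
  also have "\<dots> = \<delta> * (\<Sum>k\<in>K. G k)" by (simp only: sum_distrib_left)
  also have "\<dots> \<le> \<delta> * (2 ^ CARD('d) * (real M ^ (CARD('d) + 1) * real (card P)))"
    by (intro mult_left_mono sum_G \<open>\<delta> \<ge> 0\<close>)
  finally have "G 0 \<le> norm (\<Sum>k\<in>K. \<psi> k * of_real (G k)) + \<delta> * (2 ^ CARD('d) * (real M ^ (CARD('d) + 1) * real (card P)))"
    using G_nonneg[of 0] by simp
  then show ?thesis using lower upper unfolding M_def by (simp only: mult_ac)
qed

section \<open>Averaging over lattice translates\<close>

definition lattice_point :: "nat \<Rightarrow> (int ^ 'd::finite) \<times> int \<Rightarrow> (real ^ 'd) \<times> real" where
  "lattice_point M z = ((\<chi> i. of_int (fst z $ i) / real M), of_int (snd z) / real M)"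

text \<open>The count is integrated over one cell of the lattice, whose translates cover the torus.\<close>

lemma measure_le_lattice_count:
  fixes E :: "((real ^ 'd::finite) \<times> real) set"
  assumes M: "M > 0" and E: "E \<subseteq> torus" "E \<in> sets borel"
    and count: "\<And>p. real (card {z \<in> lattice_box M. p + lattice_point M z \<in> E}) \<le> B"
  shows "measure lebesgue E \<le> B / real M ^ (CARD('d) + 1)"
proof -
  \<comment> \<open>A closed cell will do: neighbouring translates overlap, but only a covering of
    \<open>E\<close> is needed for an upper bound.\<close>
  define cell where "cell = cbox (0 :: (real ^ 'd) \<times> real) ((\<chi> i. 1 / real M), 1 / real M)"
  define A where "A z = cell \<inter> (\<lambda>p. p + lattice_point M z) -` E" for z
  let ?G = "lattice_box M :: ((int ^ 'd) \<times> int) set"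
  have cell: "cell \<in> lmeasurable" by (simp add: cell_def)
  have A_borel: "A z \<in> sets borel" for z
  proof -
    have "(\<lambda>p. p + lattice_point M z) \<in> borel_measurable borel" by measurable
    then have "(\<lambda>p. p + lattice_point M z) -` E \<inter> space borel \<in> sets borel" using E(2) by (rule measurable_sets)
    then show ?thesis unfolding A_def cell_def by auto
  qed
  have A: "A z \<in> lmeasurable" for z
    using A_borel[of z] by (intro fmeasurableI2[OF cell]) (auto simp: A_def)
  have A_int: "integrable lebesgue (indicator (A z) :: _ \<Rightarrow> real)" for z
    using A[of z] by (simp only: lmeasurable_iff_integrable)
  have cover: "E \<subseteq> (\<Union>z\<in>?G. (+) (lattice_point M z) ` A z)"
  proof
    fix p assume p: "p \<in> E"
    obtain x t where xt: "p = (x, t)" by fastforce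
    define z where "z = ((\<chi> i. \<lfloor>real M * x $ i\<rfloor>) :: int ^ 'd, \<lfloor>real M * t\<rfloor>)"
    have T: "0 \<le> x $ i" "x $ i < 1" "0 \<le> t" "t < 1" for i
      using p E(1) xt by (auto simp: torus_def)
    have fl: "\<lfloor>real M * y\<rfloor> \<in> {0..<int M}" "0 \<le> y - of_int \<lfloor>real M * y\<rfloor> / real M" "y - of_int \<lfloor>real M * y\<rfloor> / real M \<le> 1 / real M"
      if y: "0 \<le> y" "y < 1" for y :: real
    proof -
      have "real M * y < real M * 1" using M y by (intro mult_strict_left_mono) auto
      then show "\<lfloor>real M * y\<rfloor> \<in> {0..<int M}" using y by (auto simp: floor_less_iff)
      have "of_int \<lfloor>real M * y\<rfloor> / real M \<le> (real M * y) / real M"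
        by (intro divide_right_mono) auto
      then show "0 \<le> y - of_int \<lfloor>real M * y\<rfloor> / real M" using M by simp
      have "(real M * y - of_int \<lfloor>real M * y\<rfloor>) / real M \<le> 1 / real M"
        by (intro divide_right_mono) (linarith, simp)
      then show "y - of_int \<lfloor>real M * y\<rfloor> / real M \<le> 1 / real M" using M by (simp add: diff_divide_distrib)
    qed
    have "z \<in> ?G" using fl(1) T by (auto simp: lattice_box_def z_def)
    moreover have "p - lattice_point M z \<in> A z"
    proof -
      have "p - lattice_point M z \<in> cell"
        unfolding cell_def xt lattice_point_def z_def zero_prod_def cbox_Pair_eq
        using fl(2,3) T by (auto simp: mem_box_cart)
      then show ?thesis using p by (simp add: A_def)
    qed
    moreover have "p = lattice_point M z + (p - lattice_point M z)" by simp
    ultimately show "p \<in> (\<Union>z\<in>?G. (+) (lattice_point M z) ` A z)" by blast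
  qed
  have "measure lebesgue E \<le> measure lebesgue (\<Union>z\<in>?G. (+) (lattice_point M z) ` A z)"
    using E A finite_lattice_box by (intro measure_mono_fmeasurable cover) (auto intro!: fmeasurable.finite_UN measurable_translation)
  also have "\<dots> \<le> (\<Sum>z\<in>?G. measure lebesgue ((+) (lattice_point M z) ` A z))"
    using A by (intro measure_UNION_le finite_lattice_box) (auto intro!: fmeasurableD measurable_translation)
  also have "\<dots> = (\<Sum>z\<in>?G. measure lebesgue (A z))" by (simp add: measure_translation)
  also have "\<dots> = (\<Sum>z\<in>?G. integral\<^sup>L lebesgue (indicator (A z)))" by simp
  also have "\<dots> = integral\<^sup>L lebesgue (\<lambda>p. \<Sum>z\<in>?G. indicator (A z) p)"
    by (rule Bochner_Integration.integral_sum[symmetric]) (rule A_int)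
  \<comment> \<open>At a point \<open>p\<close> of the cell the sum of indicators is the number of
    lattice translates of \<open>p\<close> in \<open>E\<close>, which \<open>count\<close>
    bounds.\<close>
  also have "\<dots> \<le> integral\<^sup>L lebesgue (\<lambda>p. B * indicator cell p)"
  proof (rule integral_mono)
    show "integrable lebesgue (\<lambda>p. \<Sum>z\<in>?G. indicator (A z) p :: real)"
      by (rule Bochner_Integration.integrable_sum) (rule A_int)
    show "integrable lebesgue (\<lambda>p. B * indicator cell p)"
      using cell by (intro integrable_mult_right) (simp only: lmeasurable_iff_integrable)
    fix p
    have "(\<Sum>z\<in>?G. indicator (A z) p) = (\<Sum>z\<in>?G. if p \<in> cell \<and> p + lattice_point M z \<in> E then 1 else 0 :: real)"
      by (intro sum.cong refl) (auto simp: A_def indicator_def)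
    also have "\<dots> = real (card {z \<in> ?G. p \<in> cell \<and> p + lattice_point M z \<in> E})"
      by (simp add: sum.If_cases[OF finite_lattice_box] Int_def)
    also have "\<dots> \<le> B * indicator cell p" using count[of p] by (cases "p \<in> cell") auto
    finally show "(\<Sum>z\<in>?G. indicator (A z) p) \<le> B * indicator cell p" .
  qed
  also have "\<dots> = B * measure lebesgue cell" by simp
  also have "measure lebesgue cell = (1 / real M) ^ (CARD('d) + 1)"
  proof -
    have "measure lebesgue cell = measure lborel (cbox (0 :: real ^ 'd) (\<chi> i. 1 / real M)) * measure lborel (cbox 0 (1 / real M))"
      unfolding cell_def zero_prod_def by (simp add: content_Pair)
    also have "measure lborel (cbox (0 :: real ^ 'd) (\<chi> i. 1 / real M)) = (\<Prod>i\<in>(UNIV :: 'd set). 1 / real M)"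
      by (subst content_cbox_cart) (auto simp: interval_eq_empty_cart)
    finally show ?thesis by simp
  qed
  finally show ?thesis by (simp add: power_divide)
qed

lemma level_set_borel:
  fixes a :: "int ^ 'd::finite \<Rightarrow> complex"
  shows "level_set N a lam \<in> sets borel"
proof -
  have "open {p. lam < norm (exp_sum N a (fst p) (snd p))}"
    unfolding exp_sum_def by (intro open_Collect_less continuous_intros)
  moreover have "torus = {p :: (real ^ 'd) \<times> real. (\<forall>j. 0 \<le> fst p $ j \<and> fst p $ j < 1) \<and> 0 \<le> snd p \<and> snd p < 1}"
    by (auto simp: torus_def)
  moreover have "{p :: (real ^ 'd) \<times> real. (\<forall>j. 0 \<le> fst p $ j \<and> fst p $ j < 1) \<and> 0 \<le> snd p \<and> snd p < 1} \<in> sets borel"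
  proof -
    have "{p :: (real ^ 'd) \<times> real. (\<forall>j. 0 \<le> fst p $ j \<and> fst p $ j < 1) \<and> 0 \<le> snd p \<and> snd p < 1}
      = {p. (\<forall>j. 0 \<le> fst p $ j) \<and> 0 \<le> snd p} \<inter> {p. (\<forall>j. fst p $ j < 1) \<and> snd p < 1}" by auto
    moreover have "closed {p :: (real ^ 'd) \<times> real. (\<forall>j. 0 \<le> fst p $ j) \<and> 0 \<le> snd p}"
      by (intro closed_Collect_conj closed_Collect_all closed_Collect_le continuous_intros)
    moreover have "open {p :: (real ^ 'd) \<times> real. (\<forall>j. fst p $ j < 1) \<and> snd p < 1}"
    proof -
      have "{p :: (real ^ 'd) \<times> real. (\<forall>j. fst p $ j < 1) \<and> snd p < 1} = (\<Inter>j. {p. fst p $ j < 1}) \<inter> {p. snd p < 1}" by auto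
      then show ?thesis by (simp only:) (intro open_Int open_INT ballI open_Collect_less continuous_intros finite)
    qed
    ultimately show ?thesis by simp
  qed
  moreover have "level_set N a lam = torus \<inter> {p. lam < norm (exp_sum N a (fst p) (snd p))}"
    by (auto simp: level_set_def)
  ultimately show ?thesis by (simp add: sets.Int)
qed


text \<open>Translation by \<open>p\<close> multiplies each coefficient by a unimodular number, so
  the normalisation of \<open>a\<close> is preserved and the lattice estimate holds uniformly in
  \<open>p\<close>.\<close>

lemma exp_sum_lattice_shift:
  fixes a :: "int ^ 'd::finite \<Rightarrow> complex" and p :: "(real ^ 'd) \<times> real" and z :: "(int ^ 'd) \<times> int"
  shows "exp_sum N a (fst (p + lattice_point M z)) (snd (p + lattice_point M z))
    = (\<Sum>\<nu>\<in>freq_box N. a \<nu> * unit_exp ((\<Sum>j\<in>UNIV. of_int (\<nu> $ j) * fst p $ j) + of_int (sq_length \<nu>) * snd p)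
         * lattice_char M \<nu> (sq_length \<nu>) z)"
proof -
  have e: "exp (2 * complex_of_real pi * \<i> * complex_of_real r) = unit_exp r" for r
    by (simp add: unit_exp_def cis_conv_exp mult_ac)
  show ?thesis unfolding exp_sum_def e
  proof (intro sum.cong refl)
    fix \<nu> :: "int ^ 'd"
    have "(\<Sum>j\<in>UNIV. of_int (\<nu> $ j) * fst (p + lattice_point M z) $ j) + of_int (\<Sum>j\<in>UNIV. (\<nu> $ j)\<^sup>2) * snd (p + lattice_point M z)
      = ((\<Sum>j\<in>UNIV. of_int (\<nu> $ j) * fst p $ j) + of_int (sq_length \<nu>) * snd p)
        + of_int (int_dot \<nu> (fst z) + sq_length \<nu> * snd z) / real M"
      by (simp add: lattice_point_def sq_length_def int_dot_def sum.distrib distrib_left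
            add_divide_distrib sum_divide_distrib)
    then show "a \<nu> * unit_exp (\<Sum>j\<in>UNIV. of_int (\<nu> $ j) * fst (p + lattice_point M z) $ j)
        * unit_exp (of_int (\<Sum>j\<in>UNIV. (\<nu> $ j)\<^sup>2) * snd (p + lattice_point M z))
      = a \<nu> * unit_exp ((\<Sum>j\<in>UNIV. of_int (\<nu> $ j) * fst p $ j) + of_int (sq_length \<nu>) * snd p)
         * lattice_char M \<nu> (sq_length \<nu>) z"
      unfolding lattice_char_def mult.assoc unit_exp_add[symmetric] by (simp only:)
  qed
qed

lemma card_freq_box: "card (freq_box N :: (int ^ 'd::finite) set) = (2 * N + 1) ^ CARD('d)"
proof -
  have "(freq_box N :: (int ^ 'd) set) = {\<nu>. \<forall>i. \<nu> $ i \<in> {- int N..int N}}"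
    by (auto simp: freq_box_def abs_le_iff minus_le_iff)
  then have "card (freq_box N :: (int ^ 'd) set) = card (PiE (UNIV :: 'd set) (\<lambda>_. {- int N..int N}))"
    using bij_betw_same_card[OF bij_betw_vec_box[of "\<lambda>_ :: 'd. {- int N..int N}"]] by simp
  also have "\<dots> = (2 * N + 1) ^ CARD('d)" by (simp add: card_PiE nat_add_distrib nat_mult_distrib)
  finally show ?thesis .
qed

text \<open>Cauchy-Schwarz over the \<open>(2 N + 1)^d\<close> frequencies. When
  \<open>Q > N^2\<close> this is already at most a constant times
  \<open>Q powr (d / 2)\<close>.\<close>

lemma norm_exp_sum_squared_le:
  fixes a :: "int ^ 'd::finite \<Rightarrow> complex"
  assumes "(\<Sum>\<nu>\<in>freq_box N. (norm (a \<nu>))\<^sup>2) = 1"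
  shows "(norm (exp_sum N a x t))\<^sup>2 \<le> (2 * real N + 1) ^ CARD('d)"
proof -
  have "norm (exp_sum N a x t) \<le> (\<Sum>\<nu>\<in>freq_box N. norm (a \<nu>) * 1)"
    unfolding exp_sum_def by (rule order.trans[OF norm_sum]) (simp add: norm_mult)
  then have "(norm (exp_sum N a x t))\<^sup>2 \<le> (\<Sum>\<nu>\<in>freq_box N. norm (a \<nu>) * 1)\<^sup>2"
    by (intro power_mono) auto
  also have "\<dots> \<le> (\<Sum>\<nu>\<in>freq_box N. (norm (a \<nu>))\<^sup>2) * (\<Sum>\<nu>\<in>(freq_box N :: (int ^ 'd) set). 1\<^sup>2)"
    by (rule Cauchy_Schwarz_ineq_sum)
  also have "\<dots> = (2 * real N + 1) ^ CARD('d)" by (simp add: assms card_freq_box add.commute)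
  finally show ?thesis .
qed

text \<open>If the factor on the left is positive, the lattice estimate divided by
  \<open>card P\<close> bounds the count for every translate by the same number, and averaging
  cancels \<open>M^(d + 1)\<close>. Otherwise the left side is nonpositive.\<close>

lemma level_set_measure_bound:
  fixes a :: "int ^ 'd::finite \<Rightarrow> complex" and \<psi> :: "int \<Rightarrow> complex"
  assumes N: "N > 0" "64 * N \<le> n" and H: "n\<^sup>2 \<le> H"
    and \<psi>: "\<psi> 0 = 1" "\<And>k. k \<in> {- int H..<int H} \<Longrightarrow> k \<noteq> 0 \<Longrightarrow> norm (\<psi> k) \<le> \<delta>"
    and \<theta>_le: "\<And>j. norm (\<Sum>k\<in>{- int H..<int H}. \<psi> k * unit_exp (of_int k * of_int j / real (2 * H))) \<le> 64"
    and \<theta>_supp: "\<And>j. (\<Sum>k\<in>{- int H..<int H}. \<psi> k * unit_exp (of_int k * of_int j / real (2 * H))) \<noteq> 0 \<Longrightarrow>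
       \<exists>q a l. n < 4 * q \<and> q \<le> n \<and> coprime a q \<and> \<bar>of_int j / real (2 * H) - real a / real q - of_int l\<bar> < 1 / (2 * (real n)\<^sup>2)"
    and \<delta>: "\<delta> \<ge> 0" and a: "(\<Sum>\<nu>\<in>freq_box N. (norm (a \<nu>))\<^sup>2) = 1" and lam: "lam \<ge> 0"
  shows "(lam\<^sup>2 - 64 * sqrt (216 * real n) ^ CARD('d)) * measure lebesgue (level_set N a lam) \<le> 2 ^ CARD('d) * \<delta>"
proof (cases "lam\<^sup>2 - 64 * sqrt (216 * real n) ^ CARD('d) > 0")
  case True
  define A where "A = 64 * sqrt (216 * real n) ^ CARD('d)"
  define M where "M = 2 * H"
  define D where "D = 2 ^ CARD('d) * \<delta> * real M ^ (CARD('d) + 1)"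
  have A: "lam\<^sup>2 - A > 0" using True by (simp add: A_def)
  have M: "M > 0" using N H by (auto simp: M_def intro!: Nat.gr0I)
  have "D \<ge> 0" using \<delta> by (simp add: D_def)
  have "real (card {z \<in> lattice_box M. p + lattice_point M z \<in> level_set N a lam}) \<le> D / (lam\<^sup>2 - A)" for p
  proof -
    define P where "P = {z \<in> lattice_box M. p + lattice_point M z \<in> level_set N a lam}"
    define u where "u \<nu> = unit_exp ((\<Sum>j\<in>UNIV. of_int (\<nu> $ j) * fst p $ j) + of_int (sq_length \<nu>) * snd p)" for \<nu> :: "int ^ 'd"
    have "lam\<^sup>2 * (real (card P))\<^sup>2 \<le> A * (real (card P))\<^sup>2 + D * real (card P)"
      unfolding A_def D_def M_def
    proof (rule lattice_level_set_bound[OF N H \<psi> \<theta>_le \<theta>_supp \<delta> _ lam])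
      show "(\<Sum>\<nu>\<in>freq_box N. (norm (a \<nu> * u \<nu>))\<^sup>2) = 1" using a by (simp add: norm_mult u_def)
      show "P \<subseteq> lattice_box (2 * H)" by (auto simp: P_def M_def)
      fix z assume "z \<in> P"
      then have "lam < norm (exp_sum N a (fst (p + lattice_point M z)) (snd (p + lattice_point M z)))"
        by (simp add: P_def level_set_def case_prod_unfold del: fst_add snd_add)
      then show "lam < norm (\<Sum>\<nu>\<in>freq_box N. a \<nu> * u \<nu> * lattice_char (2 * H) \<nu> (sq_length \<nu>) z)"
        unfolding exp_sum_lattice_shift u_def M_def .
    qed
    then have "real (card P) * ((lam\<^sup>2 - A) * real (card P)) \<le> real (card P) * D"
      by (simp add: power2_eq_square algebra_simps)
    then have "(lam\<^sup>2 - A) * real (card P) \<le> D"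
      using \<open>D \<ge> 0\<close> by (cases "card P = 0") auto
    then show ?thesis using A by (simp add: P_def pos_le_divide_eq mult.commute)
  qed
  then have "measure lebesgue (level_set N a lam) \<le> D / (lam\<^sup>2 - A) / real M ^ (CARD('d) + 1)"
    by (intro measure_le_lattice_count M level_set_borel) (auto simp: level_set_def)
  also have "\<dots> = 2 ^ CARD('d) * \<delta> / (lam\<^sup>2 - A)" using M by (simp add: D_def)
  finally show ?thesis using A by (simp add: A_def pos_le_divide_eq mult.commute)
next
  case False
  then have "(lam\<^sup>2 - 64 * sqrt (216 * real n) ^ CARD('d)) * measure lebesgue (level_set N a lam) \<le> 0"
    by (intro mult_nonpos_nonneg) auto
  also have "0 \<le> 2 ^ CARD('d) * \<delta>" using \<delta> by simp
  finally show ?thesis .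
qed

section \<open>Choice of the parameters\<close>

lemma sqrt_power_eq_powr: "x > 0 \<Longrightarrow> sqrt x ^ d = x powr (real d / 2)"
  by (simp add: powr_half_sqrt[symmetric] powr_powr flip: powr_realpow)

theorem theorem1p2:
  fixes \<epsilon> :: real
  assumes "\<epsilon> > 0"
  shows "\<exists>C1 C2 :: real. \<forall>(N :: nat) (a :: int ^ 'd::finite \<Rightarrow> complex) (Q :: real) (lam :: real).
           N \<ge> 1 \<longrightarrow> (\<Sum>n\<in>freq_box N. (norm (a n))\<^sup>2) = 1 \<longrightarrow> Q > 0 \<longrightarrow> Q \<ge> real N \<longrightarrow> lam > 0 \<longrightarrow>
             lam\<^sup>2 * (measure lebesgue (level_set N a lam))\<^sup>2
               \<le> C1 * Q powr (real CARD('d) / 2) * (measure lebesgue (level_set N a lam))\<^sup>2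
                 + C2 * real N powr \<epsilon> / Q * measure lebesgue (level_set N a lam)"
proof -
  let ?d = "CARD('d)"
  \<comment> \<open>The multiplier loses \<open>(2 n^2) powr e\<close>, which for \<open>n\<close>
    of size \<open>Q <= N^2\<close> is of size \<open>N powr (4 * e)\<close>. The cap 2 is required
    by \<open>minor_arc_multiplier\<close>.\<close>
  define e where "e = min (\<epsilon> / 4) 2"
  have e: "0 < e" "e \<le> 2" "4 * e \<le> \<epsilon>" using assms by (auto simp: e_def)
  obtain C where C: "C > 0" "\<And>k. k > 0 \<Longrightarrow> real (num_divisors k) \<le> C * real k powr e"
    using num_divisors_bound[OF e(1)] by blast
  \<comment> \<open>\<open>27648 = 216 * 128\<close> comes from Weyl's bound with
    \<open>n <= 128 Q\<close>, and \<open>3 ^ d\<close> from the trivial bound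
    \<open>2 N + 1 <= 3 N\<close>. In \<open>C2\<close> below, \<open>32768 = 2 * 128^2\<close>
    bounds \<open>2 n^2\<close> by \<open>32768 Q^2\<close>.\<close>
  define C1 where "C1 = 64 * sqrt 27648 ^ ?d + 3 ^ ?d"
  define C2 where "C2 = 2 ^ ?d * (32 * C * 32768 powr e)"
  have "lam\<^sup>2 * (measure lebesgue (level_set N a lam))\<^sup>2
               \<le> C1 * Q powr (real ?d / 2) * (measure lebesgue (level_set N a lam))\<^sup>2
                 + C2 * real N powr \<epsilon> / Q * measure lebesgue (level_set N a lam)"
    if N: "N \<ge> 1" and a: "(\<Sum>n\<in>freq_box N. (norm (a n))\<^sup>2) = 1" and Q: "Q \<ge> real N" and lam: "lam > 0"
    for N :: nat and a :: "int ^ 'd \<Rightarrow> complex" and Q lam :: real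
  proof -
    let ?m = "measure lebesgue (level_set N a lam)"
    have Q1: "Q \<ge> 1" using N Q by linarith
    have C2_nonneg: "C2 * real N powr \<epsilon> / Q \<ge> 0" using C Q1 by (simp add: C2_def)
    \<comment> \<open>The claim with one factor \<open>|E|\<close> divided out; it also makes sense
      for a null set, and multiplying by \<open>|E|\<close> at the end recovers the theorem.\<close>
    have "(lam\<^sup>2 - C1 * Q powr (real ?d / 2)) * ?m \<le> C2 * real N powr \<epsilon> / Q"
    proof (cases "Q \<le> (real N)\<^sup>2")
      case True
      \<comment> \<open>The factor 64 makes every \<open>q > n / 4\<close> exceed
        \<open>16 Q >= 16 N\<close>. Rounding up at most doubles \<open>Q\<close>, as
        \<open>Q >= 1\<close>, which gives \<open>n <= 128 Q\<close>.\<close>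
      define n where "n = 64 * nat \<lceil>Q\<rceil>"
      have n: "64 * N \<le> n" "n \<ge> 8" "64 * Q \<le> real n" "real n \<le> 128 * Q"
      proof -
        have "real (nat \<lceil>Q\<rceil>) \<ge> Q" "real (nat \<lceil>Q\<rceil>) \<le> 2 * Q" using Q1 by linarith+
        then show "64 * Q \<le> real n" "real n \<le> 128 * Q" by (simp_all add: n_def)
        then have "64 * real N \<le> real n" "8 \<le> real n" using Q Q1 by linarith+
        then show "64 * N \<le> n" "n \<ge> 8" by linarith+
      qed
      define \<delta> where "\<delta> = 32 * C * (2 * (real n)\<^sup>2) powr e / real n"
      have "\<delta> \<ge> 0" using C by (simp add: \<delta>_def)
      obtain H \<psi> where H\<psi>: "n\<^sup>2 \<le> H" "\<psi> 0 = 1"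
        "\<And>k. k \<in> {- int H..<int H} \<Longrightarrow> k \<noteq> 0 \<Longrightarrow> norm (\<psi> k) \<le> \<delta>"
        "\<And>j. norm (\<Sum>k\<in>{- int H..<int H}. \<psi> k * unit_exp (of_int k * of_int j / real (2 * H))) \<le> 64"
        "\<And>j. (\<Sum>k\<in>{- int H..<int H}. \<psi> k * unit_exp (of_int k * of_int j / real (2 * H))) \<noteq> 0 \<Longrightarrow>
           \<exists>q a l. n < 4 * q \<and> q \<le> n \<and> coprime a q \<and> \<bar>of_int j / real (2 * H) - real a / real q - of_int l\<bar> < 1 / (2 * (real n)\<^sup>2)"
        using minor_arc_multiplier[OF e(1,2) C(2) n(2)] unfolding \<delta>_def by blast
      have "(lam\<^sup>2 - 64 * sqrt (216 * real n) ^ ?d) * ?m \<le> 2 ^ ?d * \<delta>"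
        by (rule level_set_measure_bound[OF _ n(1) H\<psi> \<open>\<delta> \<ge> 0\<close> a]) (use N lam in auto)
      moreover have "64 * sqrt (216 * real n) ^ ?d \<le> C1 * Q powr (real ?d / 2)"
      proof -
        have "sqrt (216 * real n) ^ ?d \<le> sqrt (27648 * Q) ^ ?d"
          using n by (intro power_mono real_sqrt_le_mono) auto
        also have "\<dots> = sqrt 27648 ^ ?d * Q powr (real ?d / 2)"
          using Q1 by (simp only: real_sqrt_mult power_mult_distrib sqrt_power_eq_powr)
        finally have "64 * sqrt (216 * real n) ^ ?d \<le> 64 * sqrt 27648 ^ ?d * Q powr (real ?d / 2)" by simp
        also have "\<dots> \<le> C1 * Q powr (real ?d / 2)" unfolding C1_def by (intro mult_right_mono) auto
        finally show ?thesis .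
      qed
      then have "(lam\<^sup>2 - C1 * Q powr (real ?d / 2)) * ?m \<le> (lam\<^sup>2 - 64 * sqrt (216 * real n) ^ ?d) * ?m"
        by (intro mult_right_mono) auto
      moreover have "2 ^ ?d * \<delta> \<le> C2 * real N powr \<epsilon> / Q"
      proof -
        have "(real n)\<^sup>2 \<le> (128 * Q)\<^sup>2" using n by (intro power_mono) auto
        also have "\<dots> \<le> (128 * (real N)\<^sup>2)\<^sup>2" using True Q1 by (intro power_mono) auto
        also have "\<dots> = 16384 * real N ^ 4" by (simp add: power_mult_distrib flip: power_mult)
        finally have "(2 * (real n)\<^sup>2) powr e \<le> (32768 * real N ^ 4) powr e"
          using e by (intro powr_mono2) auto
        also have "\<dots> = 32768 powr e * real N powr (4 * e)"
        proof -
          have "real N ^ 4 = real N powr 4" using N by simp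
          then show ?thesis by (simp only: powr_mult powr_powr)
        qed
        also have "\<dots> \<le> 32768 powr e * real N powr \<epsilon>"
          using N e by (intro mult_left_mono powr_mono) auto
        finally have "\<delta> \<le> 32 * C * (32768 powr e * real N powr \<epsilon>) / Q"
          unfolding \<delta>_def using C n Q1 by (intro frac_le mult_left_mono) auto
        then have "2 ^ ?d * \<delta> \<le> 2 ^ ?d * (32 * C * (32768 powr e * real N powr \<epsilon>) / Q)"
          by (rule mult_left_mono) simp
        then show ?thesis by (simp add: C2_def mult_ac)
      qed
      ultimately show ?thesis by linarith
    next
      case False
      show ?thesis
      proof (cases "level_set N a lam = {}")
        case True
        then show ?thesis using C2_nonneg by simp
      next
        case nonempty: False
        then obtain x t where "lam < norm (exp_sum N a x t)" by (auto simp: level_set_def)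
        then have "lam\<^sup>2 \<le> (norm (exp_sum N a x t))\<^sup>2" using lam by (intro power_mono) auto
        also have "\<dots> \<le> (2 * real N + 1) ^ ?d" by (rule norm_exp_sum_squared_le[OF a])
        also have "\<dots> \<le> (3 * real N) ^ ?d" using N by (intro power_mono) auto
        also have "\<dots> = 3 ^ ?d * real N ^ ?d" by (rule power_mult_distrib)
        also have "\<dots> \<le> 3 ^ ?d * Q powr (real ?d / 2)"
        proof (intro mult_left_mono)
          have "real N \<le> sqrt Q" using False by (intro real_le_rsqrt) auto
          then have "real N ^ ?d \<le> sqrt Q ^ ?d" by (intro power_mono) auto
          then show "real N ^ ?d \<le> Q powr (real ?d / 2)" using Q1 by (simp add: sqrt_power_eq_powr)
        qed simp
        also have "\<dots> \<le> C1 * Q powr (real ?d / 2)" unfolding C1_def by (intro mult_right_mono) auto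
        finally have "(lam\<^sup>2 - C1 * Q powr (real ?d / 2)) * ?m \<le> 0" by (intro mult_nonpos_nonneg) auto
        then show ?thesis using C2_nonneg by linarith
      qed
    qed
    then have "(lam\<^sup>2 - C1 * Q powr (real ?d / 2)) * ?m * ?m \<le> C2 * real N powr \<epsilon> / Q * ?m"
      by (rule mult_right_mono) simp
    then show ?thesis by (simp add: power2_eq_square algebra_simps)
  qed
  then show ?thesis by blast
qed

end
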